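(* Let $a,b\in\mathbb{R}\setminus\{0\}$, $c\in\mathbb{R}$, let $\xi=A(\lambda)\,\mathrm{d}z$ with $$A(\lambda)=\begin{pmatrix}c&a\lambda^{-1}+b\lambda\\-a\lambda-b\lambda^{-1}&-c\end{pmatrix}$$ be an $\mathbb{R}$-equivariant potential and let $F_\lambda\in\Lambda\mathrm{SU}(1,1)_\sigma$ be the corresponding extended frame, on a strip $\{x+iy: x\in I,\ y\in\mathbb{R}\}$ with $I\subset\mathbb{R}$ an open interval containing $0$. Then the minimal Lagrangian surface $f^\lambda$ in $Q_2^*$ constructed from $(F_\lambda,F_{i\lambda})$ is equivariant, that is, for every $\theta\in\mathbb{R}$, every $\lambda\in\mathbb{S}^1$ and every $z$ in the strip, $$\hat{\mathfrak f}^\lambda(z+i\theta,\bar z-i\theta,\lambda)=\psi\bigl(\exp(i\theta A(\lambda)),\exp(i\theta A(i\lambda))\bigr)\,\hat{\mathfrak f}^\lambda(z,\bar z,\lambda),$$ where $\hat{\mathfrak f}^\lambda$ is the horizontal lift of $f^\lambda$ and $\psi:\Lambda\mathrm{SU}(1,1)_\sigma\times\Lambda\mathrm{SU}(1,1)_\sigma\to\Lambda\mathrm{SO}_0(2,2)_\sigma$ is the loop group homomorphism.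
   Context: On $\mathbb{C}^4$ let $\langle \boldsymbol z,\boldsymbol w\rangle=-z_1w_1-z_2w_2+z_3w_3+z_4w_4$, $(\boldsymbol z,\boldsymbol w)=\langle\boldsymbol z,\overline{\boldsymbol w}\rangle$. $\mathbb{CH}^3_1=\{[\boldsymbol z]\in\mathbb{C}P^3:(\boldsymbol z,\boldsymbol z)<0\}$ has the indefinite Kähler structure making the Hopf fibration from $\mathbb{H}^7_3(-1)=\{(\boldsymbol z,\boldsymbol z)=-1\}$ a pseudo-Riemannian submersion, and $Q_2^*$ is the connected component of $\{[\boldsymbol z]\in\mathbb{CH}^3_1:\langle\boldsymbol z,\boldsymbol z\rangle=0\}$ containing $[(1,i,0,0)]$, with the induced Kähler structure. A lift $\mathfrak f$ of $f$ to $\mathbb{H}^7_3(-1)$ is horizontal if $\langle\mathfrak f_z,\bar{\mathfrak f}\rangle=\langle\mathfrak f_{\bar z},\bar{\mathfrak f}\rangle=0$. $\mathrm{SU}(1,1)=\{A\in\mathrm{SL}(2,\mathbb{C}):\bar A^T\mathrm{diag}(1,-1)A=\mathrm{diag}(1,-1)\}$. For $G=\mathrm{SU}(1,1)$ or $\mathrm{SL}(2,\mathbb{C})$, $\Lambda G_\sigma$ is the group of loops $g:\mathbb{S}^1\to G$ (in a suitable Banach topology) with $g(-\lambda)=\mathrm{Ad}(\mathrm{diag}(1,-1))g(\lambda)$; $\Lambda^+\mathrm{SL}(2,\mathbb{C})_\sigma$ is the subgroup of loops extending holomorphically to the unit disk. $\mathrm{SO}_0(2,2)$ is the identity component of $\{A\in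 M_4(\mathbb{R}):A^T\eta A=\eta,\det A=1\}$, $\eta=\mathrm{diag}(-1,-1,1,1)$. Extended frame: $\Phi=\exp(zA(\lambda))$ solves $\mathrm{d}\Phi=\Phi\xi$, $\Phi(0)=\mathrm{Id}$; $\Phi=F_\lambda B$ is its Iwasawa decomposition with $F_\lambda\in\Lambda\mathrm{SU}(1,1)_\sigma$, $B\in\Lambda^+\mathrm{SL}(2,\mathbb{C})_\sigma$, on a strip as in the claim on which the decomposition exists ($F_\lambda$ is determined up to right multiplication by a $\lambda$-independent diagonal $\mathrm{U}(1)$-valued map, which does not affect what follows). $F_{i\lambda}$ is the loop evaluated at $i\lambda$. Surface: identify $\mathbb{R}^4_2=(\mathbb{R}^4,\langle\,,\,\rangle)$ with the matrices $\begin{pmatrix} p & \bar q \\ q & \bar p \end{pmatrix}$, $p,q\in\mathbb{C}$, via $(\mathrm{Re}\,p,\mathrm{Im}\,p,\mathrm{Re}\,q,\mathrm{Im}\,q)$, so that $\langle x,x\rangle=-\det$. With $\sigma_3=\mathrm{diag}(1,-1)$ let $X^\lambda=F_\lambda F_{i\lambda}^{-1}$ and $Y^\lambda=iF_\lambda\sigma_3F_{i\lambda}^{-1}$, regarded as $\mathbb{R}^4_2$-valued maps. Then $\hat{\mathfrak f}^\lambda=\frac{1}{\sqrt2}(X^\lambda+iY^\lambda)\in\mathbb{C}^4$ (here $i$ is the scalar of the complexification $\mathbb{C}^4=\mathbb{R}^4\otimes\mathbb{C}$; the lift may be multiplied by a constant phase) and $f^\lambda=[\hat{\mathfrak f}^\lambda]$.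 The homomorphism $\psi$ is induced by the double cover $\mathrm{SU}(1,1)\times\mathrm{SU}(1,1)\to\mathrm{SO}_0(2,2)$ given by $\psi(g,h)x=gxh^{-1}$ for $x\in\mathbb{R}^4_2$, extended complex linearly to $\mathbb{C}^4$ and applied pointwise in $\lambda$. The notation $\hat{\mathfrak f}^\lambda(z,\bar z,\lambda)$ means the value at the point $z$ and parameter $\lambda$. *)

theory Defs
  imports "HOL-Complex_Analysis.Complex_Analysis"
begin

section \<open>Two-by-two matrices\<close>

(* The type class product on vectors is componentwise; matrix products are always written with **. *)

definition mat2 :: "complex \<Rightarrow> complex \<Rightarrow> complex \<Rightarrow> complex \<Rightarrow> complex^2^2" where
  "mat2 p q r s = vector [vector [p, q], vector [r, s]]"

definition sigma3 :: "complex^2^2" where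
  "sigma3 = mat2 1 0 0 (-1)"

definition cmul :: "complex \<Rightarrow> complex^2^2 \<Rightarrow> complex^2^2" where
  "cmul w M = map_matrix (\<lambda>x. w * x) M"

definition mpow :: "complex^2^2 \<Rightarrow> nat \<Rightarrow> complex^2^2" where
  "mpow M n = (((**) M) ^^ n) (mat 1)"

definition mexp :: "complex^2^2 \<Rightarrow> complex^2^2" where
  "mexp M = (\<Sum>n. (1 / fact n) *\<^sub>R mpow M n)"

definition SL2 :: "(complex^2^2) set" where
  "SL2 = {A. det A = 1}"

definition SU11 :: "(complex^2^2) set" where
  "SU11 = {A \<in> SL2. transpose (map_matrix cnj A) ** sigma3 ** A = sigma3}"


section \<open>Twisted loop groups\<close>

(* A loop is a function on the complex plane of which only the values on the unit circle matter.
   The topology is that of uniform convergence. Every Banach topology customary for loop groups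
   (Wiener algebra, Hoelder, Sobolev above the embedding threshold) consists of continuous loops
   and is finer, so an Iwasawa decomposition in any of them is one in the sense used here. *)

definition loops :: "(complex^2^2) set \<Rightarrow> (complex \<Rightarrow> complex^2^2) set" where
  "loops G = {g. continuous_on (sphere 0 1) g \<and>
     (\<forall>\<mu>\<in>sphere 0 1. g \<mu> \<in> G \<and> g (-\<mu>) = sigma3 ** g \<mu> ** matrix_inv sigma3)}"

definition plus_loops :: "(complex \<Rightarrow> complex^2^2) set" where
  "plus_loops = {g \<in> loops SL2. \<exists>h. continuous_on (cball 0 1) h \<and> h ` cball 0 1 \<subseteq> SL2 \<and>
     (\<forall>i j. (\<lambda>\<mu>. h \<mu> $ i $ j) holomorphic_on ball 0 1) \<and> (\<forall>\<mu>\<in>sphere 0 1. h \<mu> = g \<mu>)}"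


section \<open>Equivariant potential and extended frame\<close>

definition potential :: "real \<Rightarrow> real \<Rightarrow> real \<Rightarrow> complex \<Rightarrow> complex^2^2" where
  "potential a b c \<mu> =
     mat2 (of_real c) (of_real a * inverse \<mu> + of_real b * \<mu>)
          (- of_real a * \<mu> - of_real b * inverse \<mu>) (- of_real c)"

definition strip :: "real set \<Rightarrow> complex set" where
  "strip I = {z. Re z \<in> I}"

(* F is continuously differentiable in (Re z, Im z) as a map into the Banach space of continuous
   loops: the partial derivatives exist and are jointly continuous in z and the loop parameter. *)

definition C1_loop_map :: "complex set \<Rightarrow> (complex \<Rightarrow> complex \<Rightarrow> complex^2^2) \<Rightarrow> bool" where
  "C1_loop_map S F \<longleftrightarrow> (\<exists>Fx Fy.
     (\<forall>z\<in>S. \<forall>\<mu>\<in>sphere 0 1.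
        ((\<lambda>w. F w \<mu>) has_derivative (\<lambda>h. Re h *\<^sub>R Fx z \<mu> + Im h *\<^sub>R Fy z \<mu>)) (at z)) \<and>
     continuous_on (S \<times> sphere 0 1) (\<lambda>(z, \<mu>). Fx z \<mu>) \<and>
     continuous_on (S \<times> sphere 0 1) (\<lambda>(z, \<mu>). Fy z \<mu>))"

(* The exponential of z A is the solution of d Phi = Phi A dz, Phi(0) = Id. The frame F z is
   written as a function of the loop parameter in its second argument. *)

definition extended_frame ::
    "(complex \<Rightarrow> complex^2^2) \<Rightarrow> complex set \<Rightarrow> (complex \<Rightarrow> complex \<Rightarrow> complex^2^2) \<Rightarrow> bool" where
  "extended_frame A S F \<longleftrightarrow> C1_loop_map S F \<and>
     (\<forall>z\<in>S. F z \<in> loops SU11 \<and>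
        (\<exists>B\<in>plus_loops. \<forall>\<mu>\<in>sphere 0 1. mexp (cmul z (A \<mu>)) = F z \<mu> ** B \<mu>))"


section \<open>The complex quadric\<close>

definition bil :: "complex^4 \<Rightarrow> complex^4 \<Rightarrow> complex" where
  "bil z w = - z$1 * w$1 - z$2 * w$2 + z$3 * w$3 + z$4 * w$4"

definition cvec :: "complex^4 \<Rightarrow> complex^4" where
  "cvec w = (\<chi> k. cnj (w $ k))"

definition herm :: "complex^4 \<Rightarrow> complex^4 \<Rightarrow> complex" where
  "herm z w = bil z (cvec w)"

definition H73 :: "(complex^4) set" where
  "H73 = {z. herm z z = -1}"

definition pclass :: "complex^4 \<Rightarrow> (complex^4) set" where
  "pclass z = {t *s z | t. t \<noteq> 0}"

definition CP3 :: "(complex^4) set set" where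
  "CP3 = pclass ` {z. z \<noteq> 0}"

(* the quotient topology *)

definition CP3_top :: "(complex^4) set topology" where
  "CP3_top = topology (\<lambda>U. U \<subseteq> CP3 \<and> open {z. z \<noteq> 0 \<and> pclass z \<in> U})"

lemma openin_CP3_top:
  "openin CP3_top U \<longleftrightarrow> U \<subseteq> CP3 \<and> open {z. z \<noteq> 0 \<and> pclass z \<in> U}"
proof -
  have "istopology (\<lambda>U. U \<subseteq> CP3 \<and> open {z. z \<noteq> 0 \<and> pclass z \<in> U})"
    unfolding istopology_def
  proof (intro conjI allI impI)
    fix S T :: "(complex^4) set set"
    assume S: "S \<subseteq> CP3 \<and> open {z. z \<noteq> 0 \<and> pclass z \<in> S}"
      and T: "T \<subseteq> CP3 \<and> open {z. z \<noteq> 0 \<and> pclass z \<in> T}"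
    show "S \<inter> T \<subseteq> CP3" using S by blast
    have "{z. z \<noteq> 0 \<and> pclass z \<in> S \<inter> T}
        = {z. z \<noteq> 0 \<and> pclass z \<in> S} \<inter> {z. z \<noteq> 0 \<and> pclass z \<in> T}" by blast
    then show "open {z. z \<noteq> 0 \<and> pclass z \<in> S \<inter> T}" using S T by (simp add: open_Int)
  next
    fix K :: "(complex^4) set set set"
    assume K: "\<forall>U\<in>K. U \<subseteq> CP3 \<and> open {z. z \<noteq> 0 \<and> pclass z \<in> U}"
    show "\<Union> K \<subseteq> CP3" using K by blast
    have "{z. z \<noteq> 0 \<and> pclass z \<in> \<Union> K} = (\<Union>U\<in>K. {z. z \<noteq> 0 \<and> pclass z \<in> U})" by blast
    then show "open {z. z \<noteq> 0 \<and> pclass z \<in> \<Union> K}" using K by (simp add: open_UN)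
  qed
  then show ?thesis by (simp add: CP3_top_def topology_inverse')
qed

(* herm z z is real. *)

definition CH31 :: "(complex^4) set set" where
  "CH31 = {pclass z | z. Re (herm z z) < 0}"

definition Q2star :: "(complex^4) set set" where
  "Q2star = connected_component_of_set
     (subtopology CP3_top {P \<in> CH31. \<forall>z\<in>P. bil z z = 0}) (pclass (vector [1, \<i>, 0, 0]))"

definition d_z :: "(complex \<Rightarrow> complex^4) \<Rightarrow> complex \<Rightarrow> complex^4" where
  "d_z f z = (1/2) *s (frechet_derivative f (at z) 1 - \<i> *s frechet_derivative f (at z) \<i>)"

definition d_zbar :: "(complex \<Rightarrow> complex^4) \<Rightarrow> complex \<Rightarrow> complex^4" where
  "d_zbar f z = (1/2) *s (frechet_derivative f (at z) 1 + \<i> *s frechet_derivative f (at z) \<i>)"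

definition horizontal_lift ::
    "complex set \<Rightarrow> (complex \<Rightarrow> (complex^4) set) \<Rightarrow> (complex \<Rightarrow> complex^4) \<Rightarrow> bool" where
  "horizontal_lift S f fh \<longleftrightarrow>
     (\<forall>z\<in>S. fh differentiable (at z) \<and> fh z \<in> H73 \<and> pclass (fh z) = f z \<and>
        bil (d_z fh z) (cvec (fh z)) = 0 \<and> bil (d_zbar fh z) (cvec (fh z)) = 0)"


section \<open>The surface\<close>

definition mat_of_vec :: "real^4 \<Rightarrow> complex^2^2" where
  "mat_of_vec x = (let p = Complex (x$1) (x$2); q = Complex (x$3) (x$4) in mat2 p (cnj q) q (cnj p))"

(* inverse of mat_of_vec on its range; meaningless elsewhere *)

definition vec_of_mat :: "complex^2^2 \<Rightarrow> real^4" where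
  "vec_of_mat M = vector [Re (M$1$1), Im (M$1$1), Re (M$2$1), Im (M$2$1)]"

definition surfX :: "(complex \<Rightarrow> complex \<Rightarrow> complex^2^2) \<Rightarrow> complex \<Rightarrow> complex \<Rightarrow> real^4" where
  "surfX F \<mu> z = vec_of_mat (F z \<mu> ** matrix_inv (F z (\<i> * \<mu>)))"

definition surfY :: "(complex \<Rightarrow> complex \<Rightarrow> complex^2^2) \<Rightarrow> complex \<Rightarrow> complex \<Rightarrow> real^4" where
  "surfY F \<mu> z = vec_of_mat (cmul \<i> (F z \<mu> ** sigma3 ** matrix_inv (F z (\<i> * \<mu>))))"

definition std_lift :: "(complex \<Rightarrow> complex \<Rightarrow> complex^2^2) \<Rightarrow> complex \<Rightarrow> complex \<Rightarrow> complex^4" where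
  "std_lift F \<mu> z =
     (\<chi> k. (of_real (surfX F \<mu> z $ k) + \<i> * of_real (surfY F \<mu> z $ k)) / of_real (sqrt 2))"

definition surf :: "(complex \<Rightarrow> complex \<Rightarrow> complex^2^2) \<Rightarrow> complex \<Rightarrow> complex \<Rightarrow> (complex^4) set" where
  "surf F \<mu> z = pclass (std_lift F \<mu> z)"

(* the real matrix of x |-> g x h^{-1} on R^4_2, for g and h in SU(1,1) *)

definition psi_pt :: "complex^2^2 \<Rightarrow> complex^2^2 \<Rightarrow> real^4^4" where
  "psi_pt g h = matrix (\<lambda>x. vec_of_mat (g ** mat_of_vec x ** matrix_inv h))"

definition psi ::
    "(complex \<Rightarrow> complex^2^2) \<Rightarrow> (complex \<Rightarrow> complex^2^2) \<Rightarrow> complex \<Rightarrow> complex^4^4" where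
  "psi \<gamma> \<delta> \<mu> = map_matrix of_real (psi_pt (\<gamma> \<mu>) (\<delta> \<mu>))"

end

theory Submission
  imports Defs
begin

text \<open>
  For real \<open>\<theta>\<close> and \<open>\<mu>\<close> on the circle, \<open>i \<theta> A(\<mu>)\<close> lies in \<open>su(1,1)\<close>. Comparing the two
  Iwasawa decompositions of \<open>exp((z + i \<theta>) A) = exp(i \<theta> A) exp(z A)\<close> shows that
  \<open>F(z)\<^sup>-\<^sup>1 exp(-i \<theta> A) F(z + i \<theta>) = B(z) B(z + i \<theta>)\<^sup>-\<^sup>1\<close> is at once \<open>SU(1,1)\<close>-valued on the
  circle and the boundary value of a holomorphic loop. By reflection it is constant, and by the
  twisting it is diagonal, so it cancels in both \<open>X\<close> and \<open>Y\<close>.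

  The same quotient with a small step \<open>t e\<close> in place of \<open>i \<theta>\<close>, differentiated at \<open>t = 0\<close>, shows
  that \<open>F\<^sup>-\<^sup>1 dF(e) - e B A B\<^sup>-\<^sup>1\<close> is a boundary value, although \<open>B\<close> is not assumed differentiable.
  The diagonal entries of \<open>F\<^sup>-\<^sup>1 dF\<close> have at most a simple pole at \<open>0\<close>, are even and are
  imaginary on the circle, so they do not depend on the loop parameter. Their values at \<open>\<mu>\<close> and
  \<open>i \<mu>\<close> therefore cancel, which is horizontality of the lift. Two horizontal lifts of the same
  map differ by a constant phase.
\<close>

no_notation fps_nth (infixl "$" 75)

section \<open>Tracefree matrices and their exponentials\<close>

lemma mat2_nth [simp]:
  "mat2 p q r s $ 1 $ 1 = p" "mat2 p q r s $ 1 $ 2 = q"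
  "mat2 p q r s $ 2 $ 1 = r" "mat2 p q r s $ 2 $ 2 = s"
  by (simp_all add: mat2_def)

lemma mat2_collapse: "mat2 (M$1$1) (M$1$2) (M$2$1) (M$2$2) = M"
  by (simp add: vec_eq_iff forall_2)

lemma mat2_eq_iff: "mat2 p q r s = mat2 p' q' r' s' \<longleftrightarrow> p = p' \<and> q = q' \<and> r = r' \<and> s = s'"
  by (auto simp: vec_eq_iff forall_2)

lemma mat2_mult:
  "mat2 p q r s ** mat2 p' q' r' s' =
     mat2 (p * p' + q * r') (p * q' + q * s') (r * p' + s * r') (r * q' + s * s')"
  by (simp add: vec_eq_iff forall_2 matrix_matrix_mult_def sum_2)

lemma det_mat2: "det (mat2 p q r s) = p * s - q * r"
  by (simp add: det_2)

lemma mat_eq_mat2: "mat k = mat2 k 0 0 k"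
  by (simp add: vec_eq_iff forall_2 mat_def)

lemma cmul_mat2: "cmul w (mat2 p q r s) = mat2 (w * p) (w * q) (w * r) (w * s)"
  by (simp add: vec_eq_iff forall_2 cmul_def map_matrix_def)

lemma cmul_nth: "cmul w M $ i $ j = w * M $ i $ j"
  by (simp add: cmul_def map_matrix_def)

lemma matrix_mult_nth_2:
  fixes M N :: "'a::semiring_1 ^ 2 ^ 2"
  shows "(M ** N) $ i $ j = M$i$1 * N$1$j + M$i$2 * N$2$j"
  by (simp add: matrix_matrix_mult_def sum_2)

text \<open>The adjugate. It is the inverse on determinant one and polynomial in the entries, so
  products with it preserve \<open>disc_ext\<close> and can be differentiated entry by
  entry.\<close>

definition adj2 :: "complex^2^2 \<Rightarrow> complex^2^2" where
  "adj2 M = mat2 (M$2$2) (- M$1$2) (- M$2$1) (M$1$1)"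

lemma adj2_mult:
  assumes "det M = 1"
  shows "adj2 M ** M = mat 1" "M ** adj2 M = mat 1"
  using assms
  by (simp_all add: adj2_def mat_eq_mat2 det_2 vec_eq_iff forall_2 matrix_mult_nth_2 algebra_simps)

lemma adj2_cancel:
  assumes "det M = 1"
  shows "X ** M ** adj2 M = X" "X ** adj2 M ** M = X"
  by (simp_all add: matrix_mul_assoc[symmetric] adj2_mult[OF assms])

text \<open>\<open>matrix_inv\<close> is a choice; \<open>adj2 M\<close> shows that its defining
  condition can be met, and associativity forces the chosen left inverse to be
  \<open>adj2 M\<close>.\<close>

lemma matrix_inv_eq_adj2:
  assumes "det M = 1"
  shows "matrix_inv M = adj2 M"
proof -
  have "matrix_inv M ** M = mat 1"
    unfolding matrix_inv_def using adj2_mult[OF assms]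
    by (rule_tac someI2[where a = "adj2 M"]) auto
  then have "matrix_inv M ** (M ** adj2 M) = adj2 M"
    by (simp add: matrix_mul_assoc)
  then show ?thesis by (simp add: adj2_mult[OF assms])
qed

lemma matrix_inv_sigma3: "matrix_inv sigma3 = sigma3"
proof -
  have s: "sigma3 ** sigma3 = mat 1"
    by (simp add: sigma3_def mat2_mult mat_eq_mat2)
  have "matrix_inv sigma3 ** sigma3 = mat 1"
    unfolding matrix_inv_def using s by (rule_tac someI2[where a = sigma3]) auto
  then have "matrix_inv sigma3 ** (sigma3 ** sigma3) = sigma3"
    by (simp add: matrix_mul_assoc)
  then show ?thesis by (simp add: s)
qed

lemma sigma3_conj_nth:
  "(sigma3 ** M ** sigma3) $ 1 $ 1 = M$1$1" "(sigma3 ** M ** sigma3) $ 1 $ 2 = - M$1$2"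
  "(sigma3 ** M ** sigma3) $ 2 $ 1 = - M$2$1" "(sigma3 ** M ** sigma3) $ 2 $ 2 = M$2$2"
  by (simp_all add: sigma3_def matrix_mult_nth_2)

text \<open>Multiplying the quadratic condition on the right by \<open>adj2 M\<close> turns it into
  \<open>transpose (map_matrix cnj M) ** sigma3 = sigma3 ** adj2 M\<close>, which is linear in the
  entries and their conjugates.\<close>

lemma SU11_iff:
  "M \<in> SU11 \<longleftrightarrow> M$2$1 = cnj (M$1$2) \<and> M$2$2 = cnj (M$1$1) \<and> det M = 1"
proof -
  obtain p q r s where M: "M = mat2 p q r s" by (metis mat2_collapse)
  have tr: "transpose (map_matrix cnj M) = mat2 (cnj p) (cnj r) (cnj q) (cnj s)"
    by (simp add: M vec_eq_iff forall_2 transpose_def map_matrix_def)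
  have "transpose (map_matrix cnj M) ** sigma3 ** M = sigma3 \<longleftrightarrow> r = cnj q \<and> s = cnj p"
    if det: "p * s - q * r = 1"
  proof
    assume "transpose (map_matrix cnj M) ** sigma3 ** M = sigma3"
    then have "transpose (map_matrix cnj M) ** sigma3 ** (M ** adj2 M) = sigma3 ** adj2 M"
      by (simp add: matrix_mul_assoc)
    then have "transpose (map_matrix cnj M) ** sigma3 = sigma3 ** adj2 M"
      using det by (simp add: adj2_mult M det_mat2)
    then show "r = cnj q \<and> s = cnj p"
      unfolding tr by (auto simp: M sigma3_def adj2_def mat2_mult mat2_eq_iff)
  next
    assume "r = cnj q \<and> s = cnj p"
    then show "transpose (map_matrix cnj M) ** sigma3 ** M = sigma3"
      using det unfolding tr by (simp add: M sigma3_def mat2_mult mat2_eq_iff algebra_simps)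
  qed
  then show ?thesis
    by (auto simp: SU11_def SL2_def M det_mat2)
qed

lemma SU11_E:
  assumes "M \<in> SU11"
  obtains p q where "M = mat2 p q (cnj q) (cnj p)" "p * cnj p - q * cnj q = 1"
proof
  show "M = mat2 (M$1$1) (M$1$2) (cnj (M$1$2)) (cnj (M$1$1))"
    using assms unfolding SU11_iff by (metis mat2_collapse)
  show "M$1$1 * cnj (M$1$1) - M$1$2 * cnj (M$1$2) = 1"
    using assms unfolding SU11_iff by (auto simp: det_2)
qed

lemma mat2_in_SU11: "p * cnj p - q * cnj q = 1 \<Longrightarrow> mat2 p q (cnj q) (cnj p) \<in> SU11"
  by (simp add: SU11_iff det_mat2)

lemma SU11_mult: "M \<in> SU11 \<Longrightarrow> N \<in> SU11 \<Longrightarrow> M ** N \<in> SU11"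
  by (simp add: SU11_iff det_mul matrix_mult_nth_2 algebra_simps)

lemma SU11_adj2: "M \<in> SU11 \<Longrightarrow> adj2 M \<in> SU11"
  by (erule SU11_E) (auto simp: SU11_iff adj2_def det_2 algebra_simps)

text \<open>The entire function sinh r / r with its removable singularity filled in. It is even, so
  its value depends only on the square of \<open>r\<close>, and the value at 0 covers nilpotent
  matrices.\<close>

definition sinhc :: "complex \<Rightarrow> complex" where
  "sinhc r = (if r = 0 then 1 else sinh r / r)"

lemma sinhc_mult: "r * sinhc r = sinh r"
  by (simp add: sinhc_def)

lemma sinhc_minus [simp]: "sinhc (- r) = sinhc r"
  by (simp add: sinhc_def)

lemma sinhc_converges: "(\<lambda>n. if even n then 0 else r ^ (n - 1) /\<^sub>R fact n) sums sinhc r"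
proof (cases "r = 0")
  case True
  \<comment> \<open>Since 0 to the power 0 is 1, the term with n = 1 is the only one that survives
    at \<open>r = 0\<close>.\<close>
  have "(\<lambda>n. if even n then 0 else r ^ (n - 1) /\<^sub>R fact n) = (\<lambda>n. if n = 1 then 1 else 0)"
    using True by (auto simp: fun_eq_iff power_0_left elim!: oddE)
  then show ?thesis using sums_single[of 1 "\<lambda>_. 1::complex"] True by (simp add: sinhc_def)
next
  case False
  have "(\<lambda>n. (if even n then 0 else r ^ n /\<^sub>R fact n) / r) sums (sinh r / r)"
    by (intro sums_divide sinh_converges)
  also have "(\<lambda>n. (if even n then 0 else r ^ n /\<^sub>R fact n) / r)
      = (\<lambda>n. if even n then 0 else r ^ (n - 1) /\<^sub>R fact n)"
    using False by (auto simp: fun_eq_iff scaleR_conv_of_real elim!: oddE)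
  finally show ?thesis using False by (simp add: sinhc_def)
qed

section \<open>Closed form of the exponential when the square is scalar\<close>

lemma mpow_Suc: "mpow M (Suc n) = M ** mpow M n"
  by (simp add: mpow_def)

lemma mpow_0: "mpow M 0 = mat 1"
  by (simp add: mpow_def)

lemma mpow_square_scalar:
  assumes "M ** M = mat (r\<^sup>2)"
  shows "mpow M n $ i $ j = (if even n then r ^ n * mat 1 $ i $ j else r ^ (n - 1) * M $ i $ j)"
proof -
  have "mpow M (2 * k) = mat (r ^ (2 * k)) \<and> mpow M (2 * k + 1) = cmul (r ^ (2 * k)) M" for k
  proof (induction k)
    case 0
    show ?case by (simp add: mpow_0 mpow_Suc vec_eq_iff cmul_nth)
  next
    case (Suc k)
    have 1: "mpow M (2 * Suc k) = mat (r ^ (2 * Suc k))"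
    proof -
      have "mpow M (2 * Suc k) = M ** mpow M (2 * k + 1)"
        by (simp add: mpow_Suc)
      also have "\<dots> = M ** cmul (r ^ (2 * k)) M"
        using Suc by metis
      also have "\<dots> = cmul (r ^ (2 * k)) (M ** M)"
        by (simp add: vec_eq_iff forall_2 cmul_nth matrix_mult_nth_2 algebra_simps)
      also have "\<dots> = mat (r ^ (2 * Suc k))"
        by (simp add: assms mat_eq_mat2 cmul_mat2 mat2_eq_iff power2_eq_square)
      finally show ?thesis .
    qed
    have "mpow M (2 * Suc k + 1) = M ** mat (r ^ (2 * Suc k))"
      using 1 by (simp only: Suc_eq_plus1[symmetric] mpow_Suc)
    also have "\<dots> = cmul (r ^ (2 * Suc k)) M"
      by (simp add: mat_eq_mat2 vec_eq_iff forall_2 cmul_nth matrix_mult_nth_2)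
    finally show ?case using 1 by simp
  qed
  from this[of "n div 2"] show ?thesis
    by (cases "even n") (auto simp: cmul_nth mat_def elim!: evenE oddE)
qed

text \<open>The even powers of \<open>M\<close> are scalar and the odd ones are multiples of
  \<open>M\<close>, so the exponential series splits into the series of cosh and
  \<open>sinhc\<close>.\<close>

lemma mexp_square_scalar:
  assumes "M ** M = mat (r\<^sup>2)"
  shows "mexp M $ i $ j = cosh r * mat 1 $ i $ j + sinhc r * M $ i $ j"
proof -
  have summand: "((1 / fact n) *\<^sub>R mpow M n) $ i $ j =
      (if even n then r ^ n /\<^sub>R fact n else 0) * mat 1 $ i $ j
      + (if even n then 0 else r ^ (n - 1) /\<^sub>R fact n) * M $ i $ j" for n i j
    by (simp add: mpow_square_scalar[OF assms] scaleR_conv_of_real[where 'a = complex] field_simps)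
  have "(\<lambda>n. ((1 / fact n) *\<^sub>R mpow M n) $ i $ j)
      sums (cosh r * mat 1 $ i $ j + sinhc r * M $ i $ j)" for i j
    unfolding summand by (intro sums_add sums_mult2 cosh_converges sinhc_converges)
  then have "(\<lambda>n. (1 / fact n) *\<^sub>R mpow M n)
      sums (\<chi> i j. cosh r * mat 1 $ i $ j + sinhc r * M $ i $ j)"
    unfolding sums_def by (intro vec_tendstoI) (simp add: sum_component)
  then show ?thesis by (simp add: mexp_def sums_unique[symmetric])
qed

text \<open>Cayley-Hamilton with vanishing trace. The branch taken by \<open>csqrt\<close> is
  immaterial, because cosh and \<open>sinhc\<close> are even.\<close>

lemma square_tracefree:
  fixes M :: "complex^2^2"
  assumes "M$2$2 = - M$1$1"
  shows "M ** M = mat (csqrt (- det M) ^ 2)"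
  using assms by (simp add: mat_eq_mat2 vec_eq_iff forall_2 matrix_mult_nth_2 det_2 algebra_simps)

lemma square_cmul: "M ** M = mat (r\<^sup>2) \<Longrightarrow> cmul w M ** cmul w M = mat ((w * r)\<^sup>2)"
proof -
  assume a: "M ** M = mat (r\<^sup>2)"
  have "cmul w M ** cmul w M = cmul (w * w) (M ** M)"
    by (simp add: vec_eq_iff forall_2 cmul_nth matrix_mult_nth_2 algebra_simps)
  then show ?thesis
    by (simp add: a mat_eq_mat2 cmul_mat2 mat2_eq_iff power2_eq_square algebra_simps)
qed

text \<open>The addition theorems of cosh and sinh, written in the coefficients
  \<open>cosh (z * r)\<close> and \<open>sinhc (z * r) * z\<close>, together with M ** M =
  r^2.\<close>

lemma mexp_add:
  assumes tf: "M$2$2 = - M$1$1"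
  shows "mexp (cmul (z + w) M) = mexp (cmul z M) ** mexp (cmul w M)"
proof -
  define r where "r = csqrt (- det M)"
  have sq: "M ** M = mat (r\<^sup>2)" unfolding r_def by (rule square_tracefree[OF tf])
  have e: "mexp (cmul w M) = mat2 (cosh (w * r) + sinhc (w * r) * w * M$1$1) (sinhc (w * r) * w * M$1$2)
      (sinhc (w * r) * w * M$2$1) (cosh (w * r) + sinhc (w * r) * w * M$2$2)" for w
    by (simp add: vec_eq_iff forall_2 mexp_square_scalar[OF square_cmul[OF sq]] cmul_nth mat_def)
  have ra: "M$1$1 * M$1$1 + M$1$2 * M$2$1 = r\<^sup>2"
    using sq by (simp add: mat_eq_mat2 vec_eq_iff forall_2 matrix_mult_nth_2)
  have a1: "cosh ((z + w) * r) = cosh (z * r) * cosh (w * r)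
        + r\<^sup>2 * (sinhc (z * r) * z) * (sinhc (w * r) * w)"
    by (simp add: distrib_right cosh_add sinhc_mult[symmetric] power2_eq_square algebra_simps)
  have a2: "sinhc ((z + w) * r) * (z + w)
      = sinhc (z * r) * z * cosh (w * r) + cosh (z * r) * (sinhc (w * r) * w)"
  \<comment> \<open>For nonzero \<open>r\<close> the identity is checked after multiplication by
    \<open>r\<close>, where it is the addition theorem of sinh; for \<open>r = 0\<close> both sides
    are z + w.\<close>
  proof (cases "r = 0")
    case False
    have "r * (sinhc ((z + w) * r) * (z + w)) = sinh ((z + w) * r)"
      by (simp add: sinhc_mult[symmetric] algebra_simps)
    also have "\<dots> = r * (sinhc (z * r) * z * cosh (w * r) + cosh (z * r) * (sinhc (w * r) * w))"
      by (simp only: distrib_right sinh_add) (simp add: sinhc_mult[symmetric] algebra_simps)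
    finally show ?thesis using False by simp
  qed (simp add: sinhc_def)
  show ?thesis
    unfolding e mat2_mult mat2_eq_iff a1 a2 tf using ra by algebra
qed

lemma mexp_0: "mexp (cmul 0 M) = mat 1"
proof -
  have z: "cmul 0 M = 0" by (simp add: vec_eq_iff cmul_nth)
  have "(0::complex^2^2) ** 0 = mat (0\<^sup>2)" by (simp add: vec_eq_iff forall_2 matrix_mult_nth_2 mat_def)
  from mexp_square_scalar[OF this] show ?thesis by (simp add: z vec_eq_iff)
qed

lemma mexp_minus:
  assumes "M$2$2 = - M$1$1"
  shows "mexp (cmul (- z) M) ** mexp (cmul z M) = mat 1" "mexp (cmul z M) ** mexp (cmul (- z) M) = mat 1"
  using mexp_add[OF assms, of "- z" z] mexp_add[OF assms, of z "- z"] by (simp_all add: mexp_0)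

lemma mexp_commute:
  assumes tf: "M$2$2 = - M$1$1"
  shows "mexp (cmul z M) ** M = M ** mexp (cmul z M)"
  by (simp add: vec_eq_iff forall_2 mexp_square_scalar[OF square_cmul[OF square_tracefree[OF tf]]]
      cmul_nth matrix_mult_nth_2 mat_def algebra_simps)

text \<open>The hypotheses say that \<open>M\<close> lies in su(1,1). Then the square of
  \<open>r\<close> is real, so conjugation sends \<open>r\<close> to \<open>r\<close> or
  \<open>- r\<close>, and the even functions cosh and \<open>sinhc\<close> take real values there.
  Determinant one is the hyperbolic Pythagorean identity.\<close>

lemma mexp_in_SU11:
  assumes "M$1$1 = \<i> * of_real t" and "M$2$2 = - M$1$1" and "M$2$1 = cnj (M$1$2)"
  shows "mexp M \<in> SU11"
proof -
  define r where "r = csqrt (- det M)"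
  have sq: "M ** M = mat (r\<^sup>2)" unfolding r_def by (rule square_tracefree[OF assms(2)])
  have det: "r\<^sup>2 = M$1$1 * M$1$1 + M$1$2 * M$2$1"
    using sq by (simp add: mat_eq_mat2 vec_eq_iff forall_2 matrix_mult_nth_2)
  also have "\<dots> = of_real ((cmod (M$1$2))\<^sup>2 - t\<^sup>2)"
    by (simp add: assms(1,3) of_real_diff complex_norm_square del: of_real_power)
       (simp add: power2_eq_square algebra_simps)
  finally have r2: "r\<^sup>2 = of_real ((cmod (M$1$2))\<^sup>2 - t\<^sup>2)" .
  then have "(cnj r)\<^sup>2 = r\<^sup>2" by (metis complex_cnj_complex_of_real complex_cnj_power)
  then have rr: "cnj r = r \<or> cnj r = - r" by (simp add: power2_eq_iff)
  have cs: "cnj (cosh x) = cosh (cnj x)" "cnj (sinh x) = sinh (cnj x)" for x :: complex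
    by (simp_all add: cosh_def sinh_def exp_cnj)
  have c: "cnj (cosh r) = cosh r" using rr by (auto simp: cs)
  have s: "cnj (sinhc r) = sinhc r" using rr by (auto simp: sinhc_def cs)
  have e: "mexp M = mat2 (cosh r + sinhc r * M$1$1) (sinhc r * M$1$2)
      (sinhc r * M$2$1) (cosh r + sinhc r * M$2$2)"
    by (simp add: vec_eq_iff forall_2 mexp_square_scalar[OF sq] mat_def)
  have "cosh r ^ 2 - sinhc r ^ 2 * r\<^sup>2 = 1"
    using hyperbolic_pythagoras[of r] sinhc_mult[of r] by (metis mult.commute power_mult_distrib)
  then have "det (mexp M) = 1"
    unfolding e det_mat2 using det assms(2) by algebra
  then show ?thesis using assms c s by (simp add: SU11_iff e)
qed

section \<open>Quadratic Taylor remainders\<close>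

lemma norm_exp_taylor_2:
  fixes w :: complex
  shows "norm (exp w - 1 - w) \<le> exp (norm w) * (norm w)\<^sup>2"
proof -
  have "norm (exp w - (\<Sum>i\<le>1. w ^ i / fact i)) \<le> exp \<bar>Re w\<bar> * norm w ^ Suc 1 / fact 1"
    by (rule Taylor_exp)
  also have "\<dots> \<le> exp (norm w) * (norm w)\<^sup>2"
    by (simp add: power2_eq_square abs_Re_le_cmod mult_right_mono)
  finally show ?thesis by (simp add: algebra_simps)
qed

lemma norm_cosh_sinh_taylor:
  fixes w :: complex
  shows "norm (cosh w - 1) \<le> exp (norm w) * (norm w)\<^sup>2" (is ?A)
    and "norm (sinh w - w) \<le> exp (norm w) * (norm w)\<^sup>2" (is ?B)
proof -
  have c: "cosh w - 1 = ((exp w - 1 - w) + (exp (-w) - 1 - (-w))) / 2"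
    by (simp add: cosh_def scaleR_conv_of_real field_simps)
  have s: "sinh w - w = ((exp w - 1 - w) - (exp (-w) - 1 - (-w))) / 2"
    by (simp add: sinh_def scaleR_conv_of_real field_simps)
  have b: "norm (exp w - 1 - w) + norm (exp (-w) - 1 - (-w)) \<le> 2 * (exp (norm w) * (norm w)\<^sup>2)"
    using norm_exp_taylor_2[of w] norm_exp_taylor_2[of "-w"] by simp
  show ?A
    unfolding c norm_divide
    using order_trans[OF norm_triangle_ineq b] by simp
  show ?B
    unfolding s norm_divide
    using order_trans[OF norm_triangle_ineq4 b] by simp
qed

text \<open>The bound depends on \<open>M\<close> only through \<open>K\<close>, so it is uniform in
  the loop parameter once the potential is bounded on the circle. In the constant,
  \<open>4 * K\<^sup>2\<close> comes from the remainder of cosh and \<open>2 * K\<^sup>2\<close>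
  from that of \<open>sinhc\<close> times an entry of \<open>M\<close>.\<close>

lemma mexp_taylor:
  assumes tf: "M$2$2 = - M$1$1" and K: "\<And>i j. norm (M$i$j) \<le> K" and w: "norm w \<le> 1"
  shows "norm (mexp (cmul w M) $ i $ j - mat 1 $ i $ j - w * M$i$j)
     \<le> exp (2 * K) * (4 * K\<^sup>2 + 2 * K\<^sup>2) * (norm w)\<^sup>2"
proof -
  define r where "r = csqrt (- det M)"
  have sq: "M ** M = mat (r\<^sup>2)" unfolding r_def by (rule square_tracefree[OF tf])
  have K0: "K \<ge> 0" using K[of 1 1] norm_ge_zero order_trans by blast
  have "r\<^sup>2 = M$1$1 * M$1$1 + M$1$2 * M$2$1"
    using sq by (simp add: mat_eq_mat2 vec_eq_iff forall_2 matrix_mult_nth_2)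
  then have "norm (r\<^sup>2) \<le> norm (M$1$1) * norm (M$1$1) + norm (M$1$2) * norm (M$2$1)"
    using norm_triangle_ineq[of "M$1$1 * M$1$1" "M$1$2 * M$2$1"] by (simp add: norm_mult)
  also have "\<dots> \<le> K * K + K * K"
    by (intro add_mono mult_mono K norm_ge_zero K0)
  also have "\<dots> \<le> (2 * K)\<^sup>2" using K0 by (simp add: power2_eq_square)
  finally have r: "norm r \<le> 2 * K"
    using K0 power2_le_imp_le[of "norm r" "2 * K"] by (simp add: norm_power)
  have wr: "norm (w * r) \<le> 2 * K"
    using mult_mono[OF w r] by (simp add: norm_mult)
  have n2: "(norm (w * r))\<^sup>2 = (norm w)\<^sup>2 * (norm r)\<^sup>2" by (simp add: norm_mult power_mult_distrib)
  have ex: "exp (norm (w * r)) \<le> exp (2 * K)" using wr by simp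
  have rr: "(norm r)\<^sup>2 \<le> 4 * K\<^sup>2"
    using power_mono[OF r norm_ge_zero, of 2] by (simp add: power_mult_distrib)
  have c: "norm (cosh (w * r) - 1) \<le> exp (2 * K) * (4 * K\<^sup>2) * (norm w)\<^sup>2"
  proof -
    have "norm (cosh (w * r) - 1) \<le> exp (norm (w * r)) * ((norm w)\<^sup>2 * (norm r)\<^sup>2)"
      using norm_cosh_sinh_taylor(1)[of "w * r"] by (simp add: n2)
    also have "\<dots> \<le> exp (2 * K) * ((norm w)\<^sup>2 * (4 * K\<^sup>2))"
      by (intro mult_mono ex rr) auto
    finally show ?thesis by (simp add: mult_ac)
  qed
  have s: "norm ((sinhc (w * r) - 1) * w) \<le> exp (2 * K) * (2 * K) * (norm w)\<^sup>2"
  proof (cases "r = 0")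
    case True
    then show ?thesis using K0 by (simp add: sinhc_def)
  next
    case False
    \<comment> \<open>One of the two factors \<open>norm r\<close> in the sinh remainder is kept for
      cancellation and the other is bounded by 2 K.\<close>
    have "norm r * norm ((sinhc (w * r) - 1) * w) = norm (sinh (w * r) - w * r)"
      by (simp add: sinhc_mult[symmetric] norm_mult[symmetric] algebra_simps)
    also have "\<dots> \<le> exp (norm (w * r)) * ((norm w)\<^sup>2 * (norm r)\<^sup>2)"
      using norm_cosh_sinh_taylor(2)[of "w * r"] by (simp add: n2)
    also have "\<dots> \<le> exp (2 * K) * ((norm w)\<^sup>2 * (norm r * (2 * K)))"
      using r by (intro mult_mono ex) (auto simp: power2_eq_square mult_left_mono)
    finally have "norm r * norm ((sinhc (w * r) - 1) * w)
        \<le> norm r * (exp (2 * K) * (2 * K) * (norm w)\<^sup>2)" by (simp add: mult_ac)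
    then show ?thesis using False by simp
  qed
  have "mexp (cmul w M) $ i $ j - mat 1 $ i $ j - w * M$i$j
      = (cosh (w * r) - 1) * mat 1 $ i $ j + ((sinhc (w * r) - 1) * w) * M$i$j"
    by (simp add: mexp_square_scalar[OF square_cmul[OF sq]] cmul_nth algebra_simps)
  also have "norm \<dots> \<le> norm (cosh (w * r) - 1) * norm (mat 1 $ i $ j :: complex)
      + norm ((sinhc (w * r) - 1) * w) * norm (M$i$j)"
    by (metis norm_mult norm_triangle_ineq)
  also have "\<dots> \<le> exp (2 * K) * (4 * K\<^sup>2) * (norm w)\<^sup>2 * 1 + exp (2 * K) * (2 * K) * (norm w)\<^sup>2 * K"
    using K0 by (intro add_mono mult_mono c s K) (auto simp: mat_def)
  also have "\<dots> = exp (2 * K) * (4 * K\<^sup>2 + 2 * K\<^sup>2) * (norm w)\<^sup>2"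
    by (simp only: power2_eq_square mult_1_right distrib_left distrib_right mult.assoc mult.left_commute mult.commute)
  finally show ?thesis .
qed


section \<open>Boundary values of holomorphic functions on the disk\<close>

text \<open>A property of the values on the circle alone. Continuity of the extension up to the
  circle is what makes the maximum principle applicable.\<close>

definition disc_ext :: "(complex \<Rightarrow> complex) \<Rightarrow> bool" where
  "disc_ext \<phi> \<longleftrightarrow> (\<exists>h. continuous_on (cball 0 1) h \<and> h holomorphic_on ball 0 1 \<and>
     (\<forall>\<mu>\<in>sphere 0 1. h \<mu> = \<phi> \<mu>))"

lemma disc_ext_cong:
  "disc_ext \<phi> \<Longrightarrow> (\<And>\<mu>. \<mu> \<in> sphere 0 1 \<Longrightarrow> \<psi> \<mu> = \<phi> \<mu>) \<Longrightarrow> disc_ext \<psi>"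
  unfolding disc_ext_def by metis

lemma disc_ext_holomorphic: "h holomorphic_on UNIV \<Longrightarrow> disc_ext h"
  unfolding disc_ext_def
  by (intro exI[of _ h]) (auto intro: holomorphic_on_subset holomorphic_on_imp_continuous_on)

lemma disc_ext_add: "disc_ext \<phi> \<Longrightarrow> disc_ext \<psi> \<Longrightarrow> disc_ext (\<lambda>\<mu>. \<phi> \<mu> + \<psi> \<mu>)"
  unfolding disc_ext_def
  apply clarify
  subgoal for h k
    by (rule exI[of _ "\<lambda>w. h w + k w"]) (auto intro!: continuous_intros holomorphic_intros)
  done

lemma disc_ext_mult: "disc_ext \<phi> \<Longrightarrow> disc_ext \<psi> \<Longrightarrow> disc_ext (\<lambda>\<mu>. \<phi> \<mu> * \<psi> \<mu>)"
  unfolding disc_ext_def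
  apply clarify
  subgoal for h k
    by (rule exI[of _ "\<lambda>w. h w * k w"]) (auto intro!: continuous_intros holomorphic_intros)
  done

lemma disc_ext_const: "disc_ext (\<lambda>_. k)"
  by (rule disc_ext_holomorphic) simp

lemma disc_ext_id: "disc_ext (\<lambda>\<mu>. \<mu>)"
  by (rule disc_ext_holomorphic) simp

lemma disc_ext_minus: "disc_ext \<phi> \<Longrightarrow> disc_ext (\<lambda>\<mu>. - \<phi> \<mu>)"
  using disc_ext_mult[OF disc_ext_const[of "-1"]] by simp

lemma disc_ext_diff: "disc_ext \<phi> \<Longrightarrow> disc_ext \<psi> \<Longrightarrow> disc_ext (\<lambda>\<mu>. \<phi> \<mu> - \<psi> \<mu>)"
  using disc_ext_add[OF _ disc_ext_minus] by simp

lemmas disc_ext_intros =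
  disc_ext_add disc_ext_mult disc_ext_const disc_ext_id disc_ext_minus disc_ext_diff

text \<open>By the maximum principle, uniform convergence on the circle propagates to the closed disk.\<close>

lemma disc_ext_uniform_limit:
  assumes "\<And>n. disc_ext (\<phi> n)" and lim: "uniform_limit (sphere 0 1) \<phi> \<psi> sequentially"
  shows "disc_ext \<psi>"
proof -
  obtain h where h: "\<And>n. continuous_on (cball 0 1) (h n)" "\<And>n. h n holomorphic_on ball 0 1"
      "\<And>n \<mu>. \<mu> \<in> sphere 0 1 \<Longrightarrow> h n \<mu> = \<phi> n \<mu>"
    using assms(1) unfolding disc_ext_def by metis
  have "uniformly_Cauchy_on (sphere 0 1) \<phi>"
    using lim uniformly_convergent_Cauchy uniformly_convergent_on_def by blast
  have "uniformly_Cauchy_on (cball 0 1) h"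
  proof (rule uniformly_Cauchy_onI)
    fix e :: real assume e: "e > 0"
    then obtain M where M: "\<And>\<mu> m n. \<mu> \<in> sphere 0 1 \<Longrightarrow> m \<ge> M \<Longrightarrow> n \<ge> M \<Longrightarrow> dist (\<phi> m \<mu>) (\<phi> n \<mu>) < e / 2"
      using \<open>uniformly_Cauchy_on (sphere 0 1) \<phi>\<close> half_gt_zero[OF e]
      unfolding uniformly_Cauchy_on_def by metis
    have "norm (h m w - h n w) \<le> e / 2" if "m \<ge> M" "n \<ge> M" "w \<in> cball 0 1" for m n w
    proof (rule maximum_modulus_frontier[of "\<lambda>w. h m w - h n w" "cball 0 1"])
      show "(\<lambda>w. h m w - h n w) holomorphic_on interior (cball 0 1)"
        using h by (auto intro!: holomorphic_intros)
      show "continuous_on (closure (cball 0 1)) (\<lambda>w. h m w - h n w)"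
        using h by (auto intro!: continuous_intros)
      show "norm (h m z - h n z) \<le> e / 2" if "z \<in> frontier (cball 0 1)" for z
        using M[of z m n] that \<open>m \<ge> M\<close> \<open>n \<ge> M\<close> h(3) by (auto simp: dist_norm)
    qed (use that in auto)
    then have "dist (h m w) (h n w) < e" if "m \<ge> M" "n \<ge> M" "w \<in> cball 0 1" for m n w
      using that e by (fastforce simp: dist_norm)
    then show "\<exists>M. \<forall>x\<in>cball 0 1. \<forall>m\<ge>M. \<forall>n\<ge>M. dist (h m x) (h n x) < e" by blast
  qed
  then obtain g where g: "uniform_limit (cball 0 1) h g sequentially"
    using Cauchy_uniformly_convergent uniformly_convergent_on_def by blast
  have "continuous_on (cball 0 1) g"
    by (rule uniform_limit_theorem[OF _ g]) (auto intro!: always_eventually h)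
  moreover have "g holomorphic_on ball 0 1"
  proof (rule holomorphic_uniform_sequence[OF open_ball h(2)])
    fix x :: complex assume "x \<in> ball 0 1"
    then obtain d where "d > 0" "cball x d \<subseteq> ball 0 1"
      by (meson open_ball open_contains_cball)
    moreover from this have "uniform_limit (cball x d) h g sequentially"
      by (intro uniform_limit_on_subset[OF g]) (use ball_subset_cball in blast)
    ultimately show "\<exists>d. 0 < d \<and> cball x d \<subseteq> ball 0 1 \<and> uniform_limit (cball x d) h g sequentially"
      by blast
  qed
  moreover have "g \<mu> = \<psi> \<mu>" if "\<mu> \<in> sphere 0 1" for \<mu>
  proof (rule LIMSEQ_unique)
    show "(\<lambda>n. h n \<mu>) \<longlonglongrightarrow> g \<mu>"
      using tendsto_uniform_limitI[OF g] that by simp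
    show "(\<lambda>n. h n \<mu>) \<longlonglongrightarrow> \<psi> \<mu>"
      using tendsto_uniform_limitI[OF lim that] h(3)[OF that] by simp
  qed
  ultimately show ?thesis unfolding disc_ext_def by blast
qed

text \<open>The maximum principle for the real parts of \<open>h\<close> and \<open>- h\<close>
  makes the real part vanish on the whole disk. A nonconstant \<open>h\<close> would be open and
  could not map into the imaginary axis; continuity carries the constant to the circle.\<close>

lemma disc_ext_imaginary_constant:
  assumes "disc_ext \<phi>" and im: "\<And>\<mu>. \<mu> \<in> sphere 0 1 \<Longrightarrow> Re (\<phi> \<mu>) = 0"
  obtains k where "\<And>\<mu>. \<mu> \<in> sphere 0 1 \<Longrightarrow> \<phi> \<mu> = k"
proof -
  obtain h where h: "continuous_on (cball 0 1) h" "h holomorphic_on ball 0 1"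
      "\<And>\<mu>. \<mu> \<in> sphere 0 1 \<Longrightarrow> h \<mu> = \<phi> \<mu>"
    using assms(1) unfolding disc_ext_def by metis
  have "Re (h w) \<le> 0" if "w \<in> cball 0 1" for w
    by (rule maximum_real_frontier[of h "cball 0 1"]) (use h im that in auto)
  moreover have "Re (- h w) \<le> 0" if "w \<in> cball 0 1" for w
    by (rule maximum_real_frontier[of "\<lambda>w. - h w" "cball 0 1"])
      (use h im that in \<open>auto intro!: holomorphic_intros continuous_intros\<close>)
  ultimately have re: "Re (h w) = 0" if "w \<in> cball 0 1" for w
    using that by (simp add: order_antisym)
  have "h constant_on ball 0 1"
  proof (rule ccontr)
    assume "\<not> h constant_on ball 0 1"
    then have o: "open (h ` ball 0 1)"
      using open_mapping_thm[OF h(2) open_ball connected_ball open_ball order_refl] by blast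
    obtain e where e: "e > 0" "ball (h 0) e \<subseteq> h ` ball 0 1"
      by (rule openE[OF o, of "h 0"]) auto
    have "h 0 + of_real (e / 2) \<in> ball (h 0) e" using e(1) by (simp add: dist_norm)
    with e obtain w where "w \<in> ball 0 1" "h w = h 0 + of_real (e / 2)" by (metis imageE subsetD)
    then have "Re (h w) = Re (h 0) + e / 2" by simp
    then show False using re[of w] re[of 0] e(1) \<open>w \<in> ball 0 1\<close> by simp
  qed
  then obtain k where k: "\<And>w. w \<in> ball 0 1 \<Longrightarrow> h w = k" unfolding constant_on_def by blast
  have "h w = k" if "w \<in> cball 0 1" for w
    by (rule continuous_constant_on_closure[of "ball 0 1"]) (use h k that in auto)
  then show ?thesis using that[of k] h(3) by fastforce
qed

text \<open>A replacement for reflection across the circle: the difference of the function and its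
  conjugate, and \<open>\<i>\<close> times their sum, are boundary values with vanishing real part,
  hence constant.\<close>

lemma disc_ext_cnj_constant:
  assumes "disc_ext \<phi>" "disc_ext (\<lambda>\<mu>. cnj (\<phi> \<mu>))"
  obtains k where "\<And>\<mu>. \<mu> \<in> sphere 0 1 \<Longrightarrow> \<phi> \<mu> = k"
proof -
  obtain k1 where k1: "\<And>\<mu>. \<mu> \<in> sphere 0 1 \<Longrightarrow> \<phi> \<mu> - cnj (\<phi> \<mu>) = k1"
    by (rule disc_ext_imaginary_constant[of "\<lambda>\<mu>. \<phi> \<mu> - cnj (\<phi> \<mu>)"])
      (use assms in \<open>auto intro!: disc_ext_intros\<close>)
  obtain k2 where k2: "\<And>\<mu>. \<mu> \<in> sphere 0 1 \<Longrightarrow> \<i> * (\<phi> \<mu> + cnj (\<phi> \<mu>)) = k2"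
    by (rule disc_ext_imaginary_constant[of "\<lambda>\<mu>. \<i> * (\<phi> \<mu> + cnj (\<phi> \<mu>))"])
      (use assms in \<open>auto intro!: disc_ext_intros\<close>)
  have "\<phi> \<mu> = (k1 - \<i> * k2) / 2" if "\<mu> \<in> sphere 0 1" for \<mu>
    using k1[OF that] k2[OF that] by (auto simp: algebra_simps)
  then show ?thesis by (rule that)
qed

text \<open>The odd part of the extension has the same boundary values and vanishes at 0, so the
  division leaves a removable singularity.\<close>

lemma disc_ext_divide_odd:
  assumes "disc_ext \<phi>" and odd: "\<And>\<mu>. \<mu> \<in> sphere 0 1 \<Longrightarrow> \<phi> (- \<mu>) = - \<phi> \<mu>"
  shows "disc_ext (\<lambda>\<mu>. \<phi> \<mu> / \<mu>)"
proof -
  obtain h where h: "continuous_on (cball 0 1) h" "h holomorphic_on ball 0 1"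
      "\<And>\<mu>. \<mu> \<in> sphere 0 1 \<Longrightarrow> h \<mu> = \<phi> \<mu>"
    using assms(1) unfolding disc_ext_def by metis
  define g where "g w = (h w - h (- w)) / 2" for w
  have g: "g holomorphic_on ball 0 1"
    unfolding g_def
    by (intro holomorphic_intros h(2) holomorphic_on_compose_gen[OF _ h(2), unfolded o_def]) auto
  have gc: "continuous_on (cball 0 1) g"
    unfolding g_def
    by (intro continuous_intros h(1) continuous_on_compose2[OF h(1)]) auto
  have [simp]: "g 0 = 0" by (simp add: g_def)
  define q where "q w = (if w = 0 then deriv g 0 else g w / w)" for w
  have qh: "q holomorphic_on ball 0 1"
    by (rule pole_theorem_open_0[OF g, of 0]) (auto simp: q_def)
  have "continuous_on (cball 0 1 - {0}) q"
  proof (rule continuous_on_eq)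
    show "continuous_on (cball 0 1 - {0}) (\<lambda>w. g w / w)"
      by (intro continuous_intros continuous_on_subset[OF gc]) auto
  qed (auto simp: q_def)
  moreover have "continuous_on (ball 0 1) q" using qh holomorphic_on_imp_continuous_on by blast
  \<comment> \<open>Continuity at 0 comes from holomorphy on the open disk, elsewhere from the
    quotient on the punctured closed disk.\<close>
  ultimately have "continuous_on (cball 0 1) q"
    unfolding continuous_on_eq_continuous_within
  proof (intro ballI)
    fix w :: complex assume w: "w \<in> cball 0 1"
      and c1: "\<forall>x\<in>cball 0 1 - {0}. continuous (at x within cball 0 1 - {0}) q"
      and c2: "\<forall>x\<in>ball 0 1. continuous (at x within ball 0 1) q"
    show "continuous (at w within cball 0 1) q"
    proof (cases "w = 0")
      case True
      then have "continuous (at w) q"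
        using c2[rule_format, of w] at_within_open[of w "ball 0 1"] by simp
      then show ?thesis by (rule continuous_at_imp_continuous_at_within)
    next
      case False
      then have "at w within cball 0 1 = at w within (cball 0 1 - {0})"
        by (intro at_within_nhd[of w "- {0}"]) auto
      then show ?thesis using c1 w False by simp
    qed
  qed
  moreover have "q \<mu> = \<phi> \<mu> / \<mu>" if "\<mu> \<in> sphere 0 1" for \<mu>
    using that odd[OF that] h(3)[of \<mu>] h(3)[of "- \<mu>"] by (auto simp: q_def g_def)
  ultimately show ?thesis unfolding disc_ext_def using qh by blast
qed

text \<open>Joint continuity on a compact product is uniform, so for small \<open>s\<close> the
  slope \<open>f' s \<mu>\<close> is within \<open>e / 2\<close> of \<open>f' 0 \<mu>\<close> for
  all parameters at once; the mean value inequality passes this on to the quotients.\<close>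

lemma uniform_limit_difference_quotient:
  fixes f f' :: "real \<Rightarrow> complex \<Rightarrow> complex"
  assumes "compact K"
    and der: "\<And>t \<mu>. t \<in> {0..\<delta>} \<Longrightarrow> \<mu> \<in> K \<Longrightarrow>
        ((\<lambda>s. f s \<mu>) has_vector_derivative f' t \<mu>) (at t within {0..\<delta>})"
    and cont: "continuous_on ({0..\<delta>} \<times> K) (\<lambda>(t, \<mu>). f' t \<mu>)"
    and \<tau>: "\<And>n. 0 < \<tau> n" "\<And>n. \<tau> n \<le> \<delta>" "\<tau> \<longlonglongrightarrow> 0"
  shows "uniform_limit K (\<lambda>n \<mu>. (f (\<tau> n) \<mu> - f 0 \<mu>) / of_real (\<tau> n)) (f' 0) sequentially"
proof (rule uniform_limitI)
  fix e :: real assume e: "e > 0"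
  have \<delta>: "0 \<le> \<delta>" using \<tau>(1,2)[of 0] by linarith
  have "uniformly_continuous_on ({0..\<delta>} \<times> K) (\<lambda>(t, \<mu>). f' t \<mu>)"
    by (intro compact_uniformly_continuous[OF cont] compact_Times) (use \<open>compact K\<close> in auto)
  then obtain d where d: "d > 0"
    "\<And>x x'. x \<in> {0..\<delta>} \<times> K \<Longrightarrow> x' \<in> {0..\<delta>} \<times> K \<Longrightarrow> dist x' x < d
       \<Longrightarrow> dist ((\<lambda>(t, \<mu>). f' t \<mu>) x') ((\<lambda>(t, \<mu>). f' t \<mu>) x) < e / 2"
    using half_gt_zero[OF e] unfolding uniformly_continuous_on_def by meson
  have ev: "\<forall>\<^sub>F n in sequentially. \<tau> n < d"
    using \<tau>(3) d(1) by (rule order_tendstoD)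
  show "\<forall>\<^sub>F n in sequentially. \<forall>\<mu>\<in>K. dist ((f (\<tau> n) \<mu> - f 0 \<mu>) / of_real (\<tau> n)) (f' 0 \<mu>) < e"
    using ev
  proof eventually_elim
    case (elim n)
    show ?case
    proof
      fix \<mu> assume \<mu>: "\<mu> \<in> K"
      have t: "0 < \<tau> n" "\<tau> n \<le> \<delta>" by (rule \<tau>)+
      have "norm (f (\<tau> n) \<mu> - f 0 \<mu> - (\<tau> n - 0) *\<^sub>R f' 0 \<mu>) \<le> norm (\<tau> n - 0) * (e / 2)"
      proof (rule vector_differentiable_bound_linearization[where S = "{0..\<tau> n}"])
        fix s assume s: "s \<in> {0..\<tau> n}"
        show "((\<lambda>s. f s \<mu>) has_vector_derivative f' s \<mu>) (at s within {0..\<tau> n})"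
          by (rule has_vector_derivative_within_subset[OF der]) (use s t \<mu> in auto)
        have "dist (f' s \<mu>) (f' 0 \<mu>) < e / 2"
          using d(2)[of "(0, \<mu>)" "(s, \<mu>)"] s t \<mu> elim \<delta> by (auto simp: dist_Pair_Pair)
        then show "norm (f' s \<mu> - f' 0 \<mu>) \<le> e / 2" by (simp add: dist_norm)
      qed (use t in \<open>auto simp: closed_segment_eq_real_ivl\<close>)
      then have "norm (f (\<tau> n) \<mu> - f 0 \<mu> - \<tau> n *\<^sub>R f' 0 \<mu>) \<le> \<tau> n * (e / 2)"
        using t by simp
      moreover have "(f (\<tau> n) \<mu> - f 0 \<mu>) / of_real (\<tau> n) - f' 0 \<mu>
          = (f (\<tau> n) \<mu> - f 0 \<mu> - \<tau> n *\<^sub>R f' 0 \<mu>) / of_real (\<tau> n)"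
        using t by (simp add: field_simps scaleR_conv_of_real)
      ultimately have "norm ((f (\<tau> n) \<mu> - f 0 \<mu>) / of_real (\<tau> n) - f' 0 \<mu>) \<le> e / 2"
        using t by (simp add: norm_divide field_simps)
      then show "dist ((f (\<tau> n) \<mu> - f 0 \<mu>) / of_real (\<tau> n)) (f' 0 \<mu>) < e"
        using e by (simp add: dist_norm)
    qed
  qed
qed


section \<open>The extended frame\<close>

lemma potential_nth [simp]:
  "potential a b c \<mu> $ 1 $ 1 = of_real c"
  "potential a b c \<mu> $ 1 $ 2 = of_real a * inverse \<mu> + of_real b * \<mu>"
  "potential a b c \<mu> $ 2 $ 1 = - of_real a * \<mu> - of_real b * inverse \<mu>"
  "potential a b c \<mu> $ 2 $ 2 = - of_real c"
  by (simp_all add: potential_def)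

lemma potential_tracefree: "potential a b c \<mu> $ 2 $ 2 = - potential a b c \<mu> $ 1 $ 1"
  by simp

lemma inverse_on_circle: "\<mu> \<in> sphere 0 1 \<Longrightarrow> inverse \<mu> = cnj \<mu>" for \<mu> :: complex
  by (simp add: complex_eq_iff inverse_complex.simps cmod_def)

text \<open>On the circle the inverse of \<open>\<mu>\<close> is its conjugate, which makes the
  off-diagonal entries of \<open>\<i> \<theta> A\<close> conjugate to each other, while the diagonal
  is imaginary.\<close>

lemma mexp_potential_in_SU11:
  assumes "\<mu> \<in> sphere 0 1"
  shows "mexp (cmul (\<i> * of_real \<theta>) (potential a b c \<mu>)) \<in> SU11"
  by (rule mexp_in_SU11[where t = "\<theta> * c"])
    (use assms in \<open>simp_all add: cmul_nth inverse_on_circle algebra_simps\<close>)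

lemma potential_continuous: "continuous_on (sphere 0 1) (\<lambda>\<mu>. potential a b c \<mu> $ i $ j)"
proof -
  have "\<forall>i j. continuous_on (sphere 0 1) (\<lambda>\<mu>. potential a b c \<mu> $ i $ j)"
    unfolding forall_2 potential_nth by (intro conjI continuous_intros) auto
  then show ?thesis by blast
qed

text \<open>The potential has at most a simple pole at 0, which the factor \<open>\<mu>\<close>
  clears.\<close>

lemma potential_disc_ext: "disc_ext (\<lambda>\<mu>. \<mu> * potential a b c \<mu> $ i $ j)"
proof -
  have "disc_ext (\<lambda>\<mu>. \<mu> * of_real c)" "disc_ext (\<lambda>\<mu>. \<mu> * - of_real c)"
    by (intro disc_ext_intros)+
  moreover have "disc_ext (\<lambda>\<mu>. \<mu> * (of_real a * inverse \<mu> + of_real b * \<mu>))"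
    by (rule disc_ext_cong[of "\<lambda>\<mu>. of_real a + of_real b * \<mu> * \<mu>"])
      (auto intro!: disc_ext_intros simp: field_simps)
  moreover have "disc_ext (\<lambda>\<mu>. \<mu> * (- of_real a * \<mu> - of_real b * inverse \<mu>))"
    by (rule disc_ext_cong[of "\<lambda>\<mu>. - of_real a * \<mu> * \<mu> - of_real b"])
      (auto intro!: disc_ext_intros simp: field_simps)
  ultimately have "\<forall>i j. disc_ext (\<lambda>\<mu>. \<mu> * potential a b c \<mu> $ i $ j)"
    unfolding forall_2 potential_nth by blast
  then show ?thesis by blast
qed

section \<open>Comparing Iwasawa decompositions\<close>

lemma plus_loops_disc_ext: "B \<in> plus_loops \<Longrightarrow> disc_ext (\<lambda>\<mu>. B \<mu> $ i $ j)"
proof -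
  assume "B \<in> plus_loops"
  then obtain h where h: "continuous_on (cball 0 1) h"
      "\<And>i j. (\<lambda>\<mu>. h \<mu> $ i $ j) holomorphic_on ball 0 1" "\<forall>\<mu>\<in>sphere 0 1. h \<mu> = B \<mu>"
    unfolding plus_loops_def by blast
  show ?thesis
    unfolding disc_ext_def
    by (rule exI[of _ "\<lambda>\<mu>. h \<mu> $ i $ j"]) (use h in \<open>auto intro!: continuous_intros\<close>)
qed

lemma plus_loops_det: "B \<in> plus_loops \<Longrightarrow> \<mu> \<in> sphere 0 1 \<Longrightarrow> det (B \<mu>) = 1"
  unfolding plus_loops_def loops_def SL2_def by blast

lemma SU11_loops:
  assumes "g \<in> loops SU11" "\<mu> \<in> sphere 0 1"
  shows "g \<mu> \<in> SU11" "det (g \<mu>) = 1"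
    "g \<mu> $ 2 $ 1 = cnj (g \<mu> $ 1 $ 2)" "g \<mu> $ 2 $ 2 = cnj (g \<mu> $ 1 $ 1)"
    "g (- \<mu>) $ 1 $ 1 = g \<mu> $ 1 $ 1" "g (- \<mu>) $ 1 $ 2 = - g \<mu> $ 1 $ 2"
    "g (- \<mu>) $ 2 $ 1 = - g \<mu> $ 2 $ 1" "g (- \<mu>) $ 2 $ 2 = g \<mu> $ 2 $ 2"
  using assms unfolding loops_def by (auto simp: SU11_iff matrix_inv_sigma3 sigma3_conj_nth)

lemma extended_frame_loops: "extended_frame A S F \<Longrightarrow> z \<in> S \<Longrightarrow> F z \<in> loops SU11"
  unfolding extended_frame_def by blast

text \<open>Cancelling \<open>mexp\<close> between the factorizations at \<open>z\<close> and
  \<open>z + w\<close> moves all frames to the left and all plus loops to the right. The step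
  \<open>w\<close> is an arbitrary complex number: it is imaginary for equivariance and small for
  differentiation.\<close>

lemma extended_frame_quotient:
  assumes F: "extended_frame (potential a b c) S F" and "z \<in> S" "z + w \<in> S"
  obtains B B' where "B \<in> plus_loops" "B' \<in> plus_loops"
    "\<And>\<mu>. \<mu> \<in> sphere 0 1 \<Longrightarrow>
      adj2 (F z \<mu>) ** mexp (cmul (- w) (potential a b c \<mu>)) ** F (z + w) \<mu> = B \<mu> ** adj2 (B' \<mu>)"
proof -
  let ?A = "potential a b c"
  obtain B where B: "B \<in> plus_loops" "\<And>\<mu>. \<mu> \<in> sphere 0 1 \<Longrightarrow> mexp (cmul z (?A \<mu>)) = F z \<mu> ** B \<mu>"
    using F \<open>z \<in> S\<close> unfolding extended_frame_def by blast
  obtain B' where B': "B' \<in> plus_loops"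
      "\<And>\<mu>. \<mu> \<in> sphere 0 1 \<Longrightarrow> mexp (cmul (z + w) (?A \<mu>)) = F (z + w) \<mu> ** B' \<mu>"
    using F \<open>z + w \<in> S\<close> unfolding extended_frame_def by blast
  show thesis
  proof (rule that[OF B(1) B'(1)])
    fix \<mu> :: complex assume \<mu>: "\<mu> \<in> sphere 0 1"
    have d: "det (F z \<mu>) = 1" "det (B' \<mu>) = 1"
      using SU11_loops(2)[OF extended_frame_loops[OF F \<open>z \<in> S\<close>] \<mu>] plus_loops_det[OF B'(1) \<mu>] by auto
    have "mexp (cmul (- w) (?A \<mu>)) ** (F (z + w) \<mu> ** B' \<mu>) = F z \<mu> ** B \<mu>"
      unfolding B(2)[OF \<mu>, symmetric] B'(2)[OF \<mu>, symmetric]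
      by (subst mexp_add[symmetric]) simp_all
    then have "adj2 (F z \<mu>) ** (mexp (cmul (- w) (?A \<mu>)) ** (F (z + w) \<mu> ** B' \<mu>)) ** adj2 (B' \<mu>)
        = adj2 (F z \<mu>) ** (F z \<mu> ** B \<mu>) ** adj2 (B' \<mu>)" by simp
    then show "adj2 (F z \<mu>) ** mexp (cmul (- w) (?A \<mu>)) ** F (z + w) \<mu> = B \<mu> ** adj2 (B' \<mu>)"
      by (simp add: matrix_mul_assoc adj2_mult adj2_cancel d)
  qed
qed

text \<open>\<open>A\<close> commutes with exp(z A) = F B, so conjugating it by the inverse of
  \<open>F\<close> is the same as conjugating it by \<open>B\<close>. This bounds the pole of the
  left side at 0.\<close>

lemma extended_frame_conjugate:
  assumes F: "extended_frame (potential a b c) S F" and "z \<in> S"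
  obtains B where "B \<in> plus_loops"
    "\<And>\<mu>. \<mu> \<in> sphere 0 1 \<Longrightarrow>
      adj2 (F z \<mu>) ** potential a b c \<mu> ** F z \<mu> = B \<mu> ** potential a b c \<mu> ** adj2 (B \<mu>)"
proof -
  let ?A = "potential a b c"
  obtain B where B: "B \<in> plus_loops" "\<And>\<mu>. \<mu> \<in> sphere 0 1 \<Longrightarrow> mexp (cmul z (?A \<mu>)) = F z \<mu> ** B \<mu>"
    using F \<open>z \<in> S\<close> unfolding extended_frame_def by blast
  show thesis
  proof (rule that[OF B(1)])
    fix \<mu> :: complex assume \<mu>: "\<mu> \<in> sphere 0 1"
    have d: "det (F z \<mu>) = 1" "det (B \<mu>) = 1"
      using SU11_loops(2)[OF extended_frame_loops[OF F \<open>z \<in> S\<close>] \<mu>] plus_loops_det[OF B(1) \<mu>] by auto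
    have "F z \<mu> ** B \<mu> ** ?A \<mu> = ?A \<mu> ** (F z \<mu> ** B \<mu>)"
      using mexp_commute[of "?A \<mu>" z] by (simp add: B(2)[OF \<mu>])
    then have "adj2 (F z \<mu>) ** (F z \<mu> ** B \<mu> ** ?A \<mu>) ** adj2 (B \<mu>)
      = adj2 (F z \<mu>) ** (?A \<mu> ** (F z \<mu> ** B \<mu>)) ** adj2 (B \<mu>)" by simp
    then show "adj2 (F z \<mu>) ** ?A \<mu> ** F z \<mu> = B \<mu> ** ?A \<mu> ** adj2 (B \<mu>)"
      by (simp add: matrix_mul_assoc adj2_mult adj2_cancel d)
  qed
qed

lemma adj2_nth [simp]:
  "adj2 M $ 1 $ 1 = M$2$2" "adj2 M $ 1 $ 2 = - M$1$2"
  "adj2 M $ 2 $ 1 = - M$2$1" "adj2 M $ 2 $ 2 = M$1$1"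
  by (simp_all add: adj2_def)

lemma extended_frame_equivariant:
  assumes F: "extended_frame (potential a b c) S F" and "z \<in> S" "z + \<i> * of_real \<theta> \<in> S"
  obtains k where "k * cnj k = 1"
    "\<And>\<mu>. \<mu> \<in> sphere 0 1 \<Longrightarrow> F (z + \<i> * of_real \<theta>) \<mu> =
      mexp (cmul (\<i> * of_real \<theta>) (potential a b c \<mu>)) ** F z \<mu> ** mat2 k 0 0 (cnj k)"
proof -
  let ?A = "potential a b c" and ?w = "\<i> * of_real \<theta>"
  note L = SU11_loops[OF extended_frame_loops[OF F \<open>z \<in> S\<close>]]
  note L' = SU11_loops[OF extended_frame_loops[OF F \<open>z + ?w \<in> S\<close>]]
  define Q where "Q \<mu> = adj2 (F z \<mu>) ** mexp (cmul (- ?w) (?A \<mu>)) ** F (z + ?w) \<mu>" for \<mu>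
  obtain B B' where B: "B \<in> plus_loops" "B' \<in> plus_loops"
    "\<And>\<mu>. \<mu> \<in> sphere 0 1 \<Longrightarrow> Q \<mu> = B \<mu> ** adj2 (B' \<mu>)"
    using extended_frame_quotient[OF assms] unfolding Q_def by metis
  \<comment> \<open>Here the step must be imaginary: only then is the exponential in the middle
    \<open>SU11\<close>-valued. The second row of \<open>Q\<close> is then conjugate to the first,
    so the first-row entries and their conjugates are all boundary values.\<close>
  have QS: "Q \<mu> \<in> SU11" if "\<mu> \<in> sphere 0 1" for \<mu>
    unfolding Q_def
    using SU11_mult SU11_adj2 L(1)[OF that] L'(1)[OF that]
      mexp_potential_in_SU11[OF that, of "- \<theta>" a b c] by simp
  have Q1: "Q \<mu> $ 1 $ 1 = B \<mu> $ 1 $ 1 * B' \<mu> $ 2 $ 2 - B \<mu> $ 1 $ 2 * B' \<mu> $ 2 $ 1"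
           "Q \<mu> $ 1 $ 2 = B \<mu> $ 1 $ 2 * B' \<mu> $ 1 $ 1 - B \<mu> $ 1 $ 1 * B' \<mu> $ 1 $ 2"
           "cnj (Q \<mu> $ 1 $ 1) = B \<mu> $ 2 $ 2 * B' \<mu> $ 1 $ 1 - B \<mu> $ 2 $ 1 * B' \<mu> $ 1 $ 2"
           "cnj (Q \<mu> $ 1 $ 2) = B \<mu> $ 2 $ 1 * B' \<mu> $ 2 $ 2 - B \<mu> $ 2 $ 2 * B' \<mu> $ 2 $ 1"
    if "\<mu> \<in> sphere 0 1" for \<mu>
  proof -
    have "cnj (Q \<mu> $ 1 $ 1) = Q \<mu> $ 2 $ 2" "cnj (Q \<mu> $ 1 $ 2) = Q \<mu> $ 2 $ 1"
      using QS[OF that] by (simp_all add: SU11_iff)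
    then show "Q \<mu> $ 1 $ 1 = B \<mu> $ 1 $ 1 * B' \<mu> $ 2 $ 2 - B \<mu> $ 1 $ 2 * B' \<mu> $ 2 $ 1"
           "Q \<mu> $ 1 $ 2 = B \<mu> $ 1 $ 2 * B' \<mu> $ 1 $ 1 - B \<mu> $ 1 $ 1 * B' \<mu> $ 1 $ 2"
           "cnj (Q \<mu> $ 1 $ 1) = B \<mu> $ 2 $ 2 * B' \<mu> $ 1 $ 1 - B \<mu> $ 2 $ 1 * B' \<mu> $ 1 $ 2"
           "cnj (Q \<mu> $ 1 $ 2) = B \<mu> $ 2 $ 1 * B' \<mu> $ 2 $ 2 - B \<mu> $ 2 $ 2 * B' \<mu> $ 2 $ 1"
      by (simp_all add: B(3)[OF that] matrix_mult_nth_2)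
  qed
  note d = plus_loops_disc_ext[OF B(1)] plus_loops_disc_ext[OF B(2)]
  have "disc_ext (\<lambda>\<mu>. Q \<mu> $ 1 $ 1)"
    by (rule disc_ext_cong[OF _ Q1(1)]) (intro disc_ext_intros d)
  moreover have "disc_ext (\<lambda>\<mu>. cnj (Q \<mu> $ 1 $ 1))"
    by (rule disc_ext_cong[OF _ Q1(3)]) (intro disc_ext_intros d)
  ultimately obtain k where k: "\<And>\<mu>. \<mu> \<in> sphere 0 1 \<Longrightarrow> Q \<mu> $ 1 $ 1 = k"
    using disc_ext_cnj_constant by blast
  have "disc_ext (\<lambda>\<mu>. Q \<mu> $ 1 $ 2)"
    by (rule disc_ext_cong[OF _ Q1(2)]) (intro disc_ext_intros d)
  moreover have "disc_ext (\<lambda>\<mu>. cnj (Q \<mu> $ 1 $ 2))"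
    by (rule disc_ext_cong[OF _ Q1(4)]) (intro disc_ext_intros d)
  ultimately obtain l where l: "\<And>\<mu>. \<mu> \<in> sphere 0 1 \<Longrightarrow> Q \<mu> $ 1 $ 2 = l"
    using disc_ext_cnj_constant by blast
  have odd: "B (-1) = sigma3 ** B 1 ** sigma3" "B' (-1) = sigma3 ** B' 1 ** sigma3"
    using B(1,2) unfolding plus_loops_def loops_def by (auto simp: matrix_inv_sigma3)
  \<comment> \<open>By the twisting the constant off-diagonal entry equals its own negative.\<close>
  have "Q (-1) $ 1 $ 2 = - Q 1 $ 1 $ 2"
    by (simp add: Q1 odd sigma3_conj_nth algebra_simps)
  with l[of 1] l[of "-1"] have l0: "l = 0" by simp
  have Qk: "Q \<mu> = mat2 k 0 0 (cnj k)" if "\<mu> \<in> sphere 0 1" for \<mu>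
    using QS[OF that] k[OF that] l[OF that] l0 by (simp add: SU11_iff vec_eq_iff forall_2)
  show thesis
  proof (rule that)
    show "k * cnj k = 1"
      using QS[of 1] Qk[of 1] by (simp add: SU11_iff det_mat2)
    fix \<mu> :: complex assume \<mu>: "\<mu> \<in> sphere 0 1"
    have "mexp (cmul ?w (?A \<mu>)) ** F z \<mu> ** Q \<mu> = F (z + ?w) \<mu>"
      unfolding Q_def
      using mexp_minus(2)[OF potential_tracefree, of ?w a b c \<mu>]
      by (simp add: matrix_mul_assoc adj2_cancel L(2)[OF \<mu>])
    then show "F (z + ?w) \<mu> = mexp (cmul ?w (?A \<mu>)) ** F z \<mu> ** mat2 k 0 0 (cnj k)"
      by (simp add: Qk[OF \<mu>])
  qed
qed

section \<open>The Maurer-Cartan form of the frame\<close>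

lemma has_derivative_eq_on_open:
  assumes "(f has_derivative f') (at z)" "(g has_derivative g') (at z)"
    and "open S" "z \<in> S" "\<And>w. w \<in> S \<Longrightarrow> f w = g w"
  shows "f' = g'"
  using has_derivative_unique[OF has_derivative_transform_within_open[OF assms(1,3,4,5)] assms(2)] .

text \<open>The entrywise relations of \<open>loops SU11\<close> hold on an open set and can be
  differentiated. Differentiating the determinant makes \<open>adj2 F ** F'\<close> tracefree; as
  its diagonal entries are conjugate, they are imaginary. Under change of sign of the parameter the
  off-diagonal signs of both factors cancel.\<close>

lemma maurer_cartan_SU11_loops:
  assumes "open S" "z \<in> S" and F: "\<And>w. w \<in> S \<Longrightarrow> F w \<in> loops SU11"
    and der: "\<And>\<mu>. \<mu> \<in> sphere 0 1 \<Longrightarrow> ((\<lambda>w. F w \<mu>) has_derivative F' \<mu>) (at z)"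
    and \<mu>: "\<mu> \<in> sphere 0 1"
  shows "F' \<mu> e $ 2 $ 1 = cnj (F' \<mu> e $ 1 $ 2)" "F' \<mu> e $ 2 $ 2 = cnj (F' \<mu> e $ 1 $ 1)"
    "Re ((adj2 (F z \<mu>) ** F' \<mu> e) $ 1 $ 1) = 0"
    "(adj2 (F z (- \<mu>)) ** F' (- \<mu>) e) $ 1 $ 1 = (adj2 (F z \<mu>) ** F' \<mu> e) $ 1 $ 1"
proof -
  have m: "- \<mu> \<in> sphere 0 1" using \<mu> by simp
  note L = SU11_loops[OF F \<mu>]
  have D: "((\<lambda>w. F w \<mu> $ i $ j) has_derivative (\<lambda>h. F' \<mu> h $ i $ j)) (at z)"
    if "\<mu> \<in> sphere 0 1" for \<mu> i j
    by (intro bounded_linear.has_derivative[OF bounded_linear_vec_nth] der that)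
  show e21: "F' \<mu> e $ 2 $ 1 = cnj (F' \<mu> e $ 1 $ 2)" for e
    using has_derivative_eq_on_open[OF D[OF \<mu>] has_derivative_cnj[OF D[OF \<mu>]] assms(1,2) L(3)]
    by (rule fun_cong)
  show e22: "F' \<mu> e $ 2 $ 2 = cnj (F' \<mu> e $ 1 $ 1)" for e
    using has_derivative_eq_on_open[OF D[OF \<mu>] has_derivative_cnj[OF D[OF \<mu>]] assms(1,2) L(4)]
    by (rule fun_cong)
  have p11: "F' (- \<mu>) e $ 1 $ 1 = F' \<mu> e $ 1 $ 1"
    using has_derivative_eq_on_open[OF D[OF m] D[OF \<mu>] assms(1,2) L(5)] by (rule fun_cong)
  have p21: "F' (- \<mu>) e $ 2 $ 1 = - F' \<mu> e $ 2 $ 1"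
    using has_derivative_eq_on_open[OF D[OF m] has_derivative_minus[OF D[OF \<mu>]] assms(1,2) L(7)]
    by (rule fun_cong)
  show "(adj2 (F z (- \<mu>)) ** F' (- \<mu>) e) $ 1 $ 1 = (adj2 (F z \<mu>) ** F' \<mu> e) $ 1 $ 1"
    using L[OF \<open>z \<in> S\<close>] by (simp add: matrix_mult_nth_2 p11 p21)
  have det: "F w \<mu> $ 1 $ 1 * F w \<mu> $ 2 $ 2 - F w \<mu> $ 1 $ 2 * F w \<mu> $ 2 $ 1 = 1" if "w \<in> S" for w
    using L(2)[OF that] by (simp add: det_2)
  have "(\<lambda>h. F z \<mu> $ 1 $ 1 * F' \<mu> h $ 2 $ 2 + F' \<mu> h $ 1 $ 1 * F z \<mu> $ 2 $ 2
      - (F z \<mu> $ 1 $ 2 * F' \<mu> h $ 2 $ 1 + F' \<mu> h $ 1 $ 2 * F z \<mu> $ 2 $ 1)) = (\<lambda>h. 0)"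
    by (rule has_derivative_eq_on_open[OF
          has_derivative_diff[OF has_derivative_mult[OF D[OF \<mu>] D[OF \<mu>]] has_derivative_mult[OF D[OF \<mu>] D[OF \<mu>]]]
          has_derivative_const assms(1,2) det])
  from fun_cong[OF this, of e]
  have "(adj2 (F z \<mu>) ** F' \<mu> e) $ 1 $ 1 + cnj ((adj2 (F z \<mu>) ** F' \<mu> e) $ 1 $ 1) = 0"
    using L(3,4)[OF \<open>z \<in> S\<close>] by (simp add: matrix_mult_nth_2 e21 e22 algebra_simps)
  then show "Re ((adj2 (F z \<mu>) ** F' \<mu> e) $ 1 $ 1) = 0"
    by (simp add: complex_eq_iff)
qed

text \<open>The analytic core of horizontality: the same \<open>k\<close> serves
  \<open>\<mu>\<close> and \<open>\<i> * \<mu>\<close>. Differentiation is carried out through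
  uniform limits of quotients, each a boundary value, with plus loops chosen afresh at every
  step.\<close>

lemma extended_frame_diagonal_constant:
  assumes frame: "extended_frame (potential a b c) S F" and S: "open S" "z \<in> S"
    and der: "\<And>\<mu>. \<mu> \<in> sphere 0 1 \<Longrightarrow> ((\<lambda>w. F w \<mu>) has_derivative F' \<mu>) (at z)"
  obtains k where "\<And>\<mu>. \<mu> \<in> sphere 0 1 \<Longrightarrow> (adj2 (F z \<mu>) ** F' \<mu> e) $ 1 $ 1 = k"
proof -
  let ?A = "potential a b c" and ?K = "sphere 0 1 :: complex set"
  let ?u = "\<lambda>\<mu>. (adj2 (F z \<mu>) ** F' \<mu> e) $ 1 $ 1"
  note loops = extended_frame_loops[OF frame]
  note MC = maurer_cartan_SU11_loops[OF S loops der]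
  obtain Fx Fy where FD: "\<And>z \<mu>. z \<in> S \<Longrightarrow> \<mu> \<in> ?K \<Longrightarrow>
        ((\<lambda>w. F w \<mu>) has_derivative (\<lambda>h. Re h *\<^sub>R Fx z \<mu> + Im h *\<^sub>R Fy z \<mu>)) (at z)"
     and FC: "continuous_on (S \<times> ?K) (\<lambda>(z, \<mu>). Fx z \<mu>)" "continuous_on (S \<times> ?K) (\<lambda>(z, \<mu>). Fy z \<mu>)"
    using frame unfolding extended_frame_def C1_loop_map_def by blast
  define D where "D w \<mu> = Re e *\<^sub>R Fx w \<mu> + Im e *\<^sub>R Fy w \<mu>" for w \<mu>
  \<comment> \<open>\<open>F'\<close> is given at \<open>z\<close> only and without continuity in
    the parameter; uniqueness of derivatives identifies it with the jointly continuous
    \<open>D\<close>.\<close>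
  have F'D: "F' \<mu> e = D z \<mu>" if "\<mu> \<in> ?K" for \<mu>
    using fun_cong[OF has_derivative_unique[OF der[OF that] FD[OF S(2) that]], of e] by (simp add: D_def)
  have Dcont: "continuous_on (S \<times> ?K) (\<lambda>x. D (fst x) (snd x))"
    using FC unfolding D_def by (auto intro!: continuous_intros simp: case_prod_beta)
  obtain r where r: "r > 0" "cball z r \<subseteq> S"
    using S by (meson open_contains_cball)
  \<comment> \<open>Steps up to \<open>\<delta>\<close> in direction \<open>e\<close> stay in the
    ball of radius \<open>r\<close> and have length at most 1, as \<open>mexp_taylor\<close>
    requires; the summand 1 in the denominator admits \<open>e = 0\<close>.\<close>
  define \<delta> where "\<delta> = min r 1 / (1 + norm e)"
  have \<delta>: "\<delta> > 0" using r by (simp add: \<delta>_def divide_pos_pos add_pos_nonneg)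
  have "\<delta> * norm e \<le> \<delta> * (1 + norm e)" using \<delta> by simp
  also have "\<dots> = min r 1" by (simp add: \<delta>_def add_pos_nonneg less_imp_neq[symmetric])
  finally have \<delta>e: "\<delta> * norm e \<le> min r 1" .
  have te: "norm (of_real t * e) \<le> min r 1" if "t \<in> {0..\<delta>}" for t
    using that \<delta>e mult_right_mono[of t \<delta> "norm e"] by (simp add: norm_mult)
  have seg: "z + of_real t * e \<in> S" if "t \<in> {0..\<delta>}" for t
    using te[OF that] r(2) by (auto simp: dist_norm subset_iff)
  define \<tau> where "\<tau> n = \<delta> / real (Suc n)" for n
  have \<tau>: "0 < \<tau> n" "\<tau> n \<le> \<delta>" for n
    using \<delta> by (simp_all add: \<tau>_def field_simps)
  have \<tau>0: "\<tau> \<longlonglongrightarrow> 0"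
    unfolding \<tau>_def using LIMSEQ_Suc[OF lim_const_over_n[of \<delta>]] by simp
  have \<tau>I: "\<tau> n \<in> {0..\<delta>}" for n using \<tau>[of n] by simp
  have U1: "uniform_limit ?K (\<lambda>n \<mu>. (F (z + of_real (\<tau> n) * e) \<mu> $ i $ j - F z \<mu> $ i $ j) / of_real (\<tau> n))
      (\<lambda>\<mu>. D z \<mu> $ i $ j) sequentially" for i j
  proof -
    have "uniform_limit ?K
      (\<lambda>n \<mu>. (F (z + of_real (\<tau> n) * e) \<mu> $ i $ j - F (z + of_real 0 * e) \<mu> $ i $ j) / of_real (\<tau> n))
      (\<lambda>\<mu>. D (z + of_real 0 * e) \<mu> $ i $ j) sequentially"
    proof (rule uniform_limit_difference_quotient[of ?K \<delta>
          "\<lambda>t \<mu>. F (z + of_real t * e) \<mu> $ i $ j" "\<lambda>t \<mu>. D (z + of_real t * e) \<mu> $ i $ j"])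
      fix t and \<mu> :: complex assume t: "t \<in> {0..\<delta>}" and \<mu>: "\<mu> \<in> ?K"
      have 1: "((\<lambda>s. z + of_real s * e) has_derivative (\<lambda>h. of_real h * e)) (at t within {0..\<delta>})"
        by (auto intro!: derivative_eq_intros)
      have 2: "((\<lambda>s. F (z + of_real s * e) \<mu>) has_derivative
          (\<lambda>h. Re (of_real h * e) *\<^sub>R Fx (z + of_real t * e) \<mu> + Im (of_real h * e) *\<^sub>R Fy (z + of_real t * e) \<mu>))
          (at t within {0..\<delta>})"
        by (rule has_derivative_compose[OF 1 FD[OF seg[OF t] \<mu>]])
      have 3: "((\<lambda>s. F (z + of_real s * e) \<mu>) has_derivative (\<lambda>h. h *\<^sub>R D (z + of_real t * e) \<mu>))
          (at t within {0..\<delta>})"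
        by (rule has_derivative_eq_rhs[OF 2]) (auto simp: D_def scaleR_add_right)
      show "((\<lambda>s. F (z + of_real s * e) \<mu> $ i $ j) has_vector_derivative D (z + of_real t * e) \<mu> $ i $ j)
          (at t within {0..\<delta>})"
        using bounded_linear.has_derivative[OF bounded_linear_vec_nth[of j]
            bounded_linear.has_derivative[OF bounded_linear_vec_nth[of i] 3]]
        by (simp add: has_vector_derivative_def)
    next
      have "continuous_on ({0..\<delta>} \<times> ?K) (\<lambda>x. D (z + of_real (fst x) * e) (snd x))"
        by (rule continuous_on_compose2[OF Dcont, of _ "\<lambda>x. (z + of_real (fst x) * e, snd x)", simplified])
          (use seg in \<open>auto intro!: continuous_intros\<close>)
      then show "continuous_on ({0..\<delta>} \<times> ?K) (\<lambda>(t, \<mu>). D (z + of_real t * e) \<mu> $ i $ j)"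
        by (auto intro!: continuous_intros simp: case_prod_beta)
    qed (use \<tau> \<tau>0 in auto)
    then show ?thesis by simp
  qed
  \<comment> \<open>Products of uniform limits are again uniform limits when the limits are bounded;
    compactness of the circle supplies the bounds.\<close>
  have Fb: "bounded ((\<lambda>\<mu>. F z \<mu> $ i $ j) ` ?K)" for i j
  proof -
    have "continuous_on ?K (F z)" using loops[OF S(2)] unfolding loops_def by blast
    then show ?thesis
      by (intro compact_imp_bounded compact_continuous_image continuous_intros) auto
  qed
  have Db: "bounded ((\<lambda>\<mu>. D z \<mu> $ i $ j) ` ?K)" for i j
  proof -
    have "continuous_on ?K (D z)"
      by (rule continuous_on_compose2[OF Dcont, of _ "\<lambda>\<mu>. (z, \<mu>)", simplified])
        (use S in \<open>auto intro!: continuous_intros\<close>)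
    then show ?thesis
      by (intro compact_imp_bounded compact_continuous_image continuous_intros) auto
  qed
  have Ab: "bounded ((\<lambda>\<mu>. ?A \<mu> $ i $ j) ` ?K)" for i j
    by (intro compact_imp_bounded compact_continuous_image potential_continuous) auto
  have "\<exists>K. \<forall>\<mu>\<in>?K. norm (?A \<mu> $ i $ j) \<le> K" for i j
    using Ab[of i j] unfolding bounded_iff by auto
  then obtain k where k: "\<And>i j \<mu>. \<mu> \<in> ?K \<Longrightarrow> norm (?A \<mu> $ i $ j) \<le> k i j"
    by metis
  define K where "K = k 1 1 + k 1 2 + k 2 1 + k 2 2"
  have kpos: "k i j \<ge> 0" for i j using order_trans[OF norm_ge_zero k[of 1 i j]] by simp
  have K: "norm (?A \<mu> $ i $ j) \<le> K" if "\<mu> \<in> ?K" for \<mu> i j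
  proof -
    have "\<forall>i j. k i j \<le> K" unfolding forall_2 K_def using kpos by (simp add: add_increasing add_increasing2)
    then show ?thesis using k[OF that, of i j] order_trans by blast
  qed
  define C where "C = exp (2 * K) * (4 * K\<^sup>2 + 2 * K\<^sup>2)"
  define E where "E n \<mu> = mexp (cmul (- (of_real (\<tau> n) * e)) (?A \<mu>))" for n \<mu>
  have U2: "uniform_limit ?K (\<lambda>n \<mu>. (E n \<mu> $ i $ j - mat 1 $ i $ j) / of_real (\<tau> n))
      (\<lambda>\<mu>. - e * ?A \<mu> $ i $ j) sequentially" for i j
  proof (rule uniform_limitI)
    fix \<epsilon> :: real assume "\<epsilon> > 0"
    have "(\<lambda>n. C * (norm e)\<^sup>2 * \<tau> n) \<longlonglongrightarrow> C * (norm e)\<^sup>2 * 0"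
      by (intro tendsto_intros \<tau>0)
    then have "\<forall>\<^sub>F n in sequentially. C * (norm e)\<^sup>2 * \<tau> n < \<epsilon>"
      using \<open>\<epsilon> > 0\<close> by (simp add: order_tendstoD)
    then show "\<forall>\<^sub>F n in sequentially. \<forall>\<mu>\<in>?K. dist ((E n \<mu> $ i $ j - mat 1 $ i $ j) / of_real (\<tau> n))
        (- e * ?A \<mu> $ i $ j) < \<epsilon>"
    proof eventually_elim
      case (elim n)
      show ?case
      proof
        fix \<mu> :: complex assume \<mu>: "\<mu> \<in> ?K"
        have "norm (E n \<mu> $ i $ j - mat 1 $ i $ j - (- (of_real (\<tau> n) * e)) * ?A \<mu> $ i $ j)
            \<le> C * (norm (- (of_real (\<tau> n) * e)))\<^sup>2"
          unfolding E_def C_def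
          by (rule mexp_taylor) (use K[OF \<mu>] te[OF \<tau>I] in auto)
        also have "\<dots> = C * (norm e)\<^sup>2 * \<tau> n * \<tau> n"
          using \<tau>(1)[of n] by (simp add: norm_mult power2_eq_square)
        finally have *: "norm (E n \<mu> $ i $ j - mat 1 $ i $ j - (- (of_real (\<tau> n) * e)) * ?A \<mu> $ i $ j)
            \<le> C * (norm e)\<^sup>2 * \<tau> n * \<tau> n" .
        have "(E n \<mu> $ i $ j - mat 1 $ i $ j) / of_real (\<tau> n) - (- e * ?A \<mu> $ i $ j)
            = (E n \<mu> $ i $ j - mat 1 $ i $ j - (- (of_real (\<tau> n) * e)) * ?A \<mu> $ i $ j) / of_real (\<tau> n)"
          using \<tau>(1)[of n] by (simp add: field_simps)
        with * have "norm ((E n \<mu> $ i $ j - mat 1 $ i $ j) / of_real (\<tau> n) - (- e * ?A \<mu> $ i $ j))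
            \<le> C * (norm e)\<^sup>2 * \<tau> n"
          using \<tau>(1)[of n] by (simp add: norm_divide pos_divide_le_eq)
        with elim show "dist ((E n \<mu> $ i $ j - mat 1 $ i $ j) / of_real (\<tau> n)) (- e * ?A \<mu> $ i $ j) < \<epsilon>"
          unfolding dist_norm by linarith
      qed
    qed
  qed
  \<comment> \<open>Uniform convergence of the frames follows by multiplying the difference
    quotients of \<open>U1\<close> by \<open>\<tau> n\<close>, which tends to 0.\<close>
  have U3: "uniform_limit ?K (\<lambda>n \<mu>. F (z + of_real (\<tau> n) * e) \<mu> $ i $ j) (\<lambda>\<mu>. F z \<mu> $ i $ j) sequentially"
    for i j
  proof -
    have "uniform_limit ?K (\<lambda>n \<mu>. of_real (\<tau> n)) (\<lambda>\<mu>. of_real 0 :: complex) sequentially"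
      using tendsto_of_real[OF \<tau>0, where 'a = complex]
      by (auto simp: uniform_limit_iff tendsto_iff)
    from uniform_lim_mult[OF this U1[of i j]]
    have "uniform_limit ?K (\<lambda>n \<mu>. of_real (\<tau> n) *
        ((F (z + of_real (\<tau> n) * e) \<mu> $ i $ j - F z \<mu> $ i $ j) / of_real (\<tau> n))) (\<lambda>\<mu>. of_real 0 * D z \<mu> $ i $ j) sequentially"
      by (simp add: Db image_constant_conv)
    from uniform_limit_add[OF this uniform_limit_const[where c = "\<lambda>\<mu>. F z \<mu> $ i $ j"]]
    show ?thesis using \<tau>(1) by (simp add: less_imp_neq[symmetric])
  qed
  define P where "P n \<mu> = (adj2 (F z \<mu>) ** E n \<mu> ** F (z + of_real (\<tau> n) * e) \<mu>) $ 1 $ 1" for n \<mu>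
  have Pd: "disc_ext (\<lambda>\<mu>. (P n \<mu> - 1) / of_real (\<tau> n))" for n
  proof -
    obtain B B' where B: "B \<in> plus_loops" "B' \<in> plus_loops"
      "\<And>\<mu>. \<mu> \<in> sphere 0 1 \<Longrightarrow> adj2 (F z \<mu>) ** E n \<mu> ** F (z + of_real (\<tau> n) * e) \<mu> = B \<mu> ** adj2 (B' \<mu>)"
      using extended_frame_quotient[OF frame S(2) seg[OF \<tau>I]] unfolding E_def by metis
    show ?thesis
    proof (rule disc_ext_cong)
      show "disc_ext (\<lambda>\<mu>. (B \<mu> $ 1 $ 1 * B' \<mu> $ 2 $ 2 + B \<mu> $ 1 $ 2 * (- B' \<mu> $ 2 $ 1) - 1) * (1 / of_real (\<tau> n)))"
        by (intro disc_ext_intros plus_loops_disc_ext B)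
      show "(P n \<mu> - 1) / of_real (\<tau> n)
          = (B \<mu> $ 1 $ 1 * B' \<mu> $ 2 $ 2 + B \<mu> $ 1 $ 2 * (- B' \<mu> $ 2 $ 1) - 1) * (1 / of_real (\<tau> n))"
        if "\<mu> \<in> ?K" for \<mu>
        by (simp add: P_def B(3)[OF that] matrix_mult_nth_2)
    qed
  qed
  \<comment> \<open>The derivative at step 0 of the quotient's upper left entry: the frame
    contributes \<open>?u\<close>, the exponential the conjugated potential.\<close>
  define \<Psi> where "\<Psi> \<mu> = ?u \<mu> - e * (adj2 (F z \<mu>) ** ?A \<mu> ** F z \<mu>) $ 1 $ 1" for \<mu>
  have Plim: "uniform_limit ?K (\<lambda>n \<mu>. (P n \<mu> - 1) / of_real (\<tau> n)) \<Psi> sequentially"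
  proof -
    let ?q = "\<lambda>n \<mu> i j. (F (z + of_real (\<tau> n) * e) \<mu> $ i $ j - F z \<mu> $ i $ j) / of_real (\<tau> n)"
    let ?p = "\<lambda>n \<mu> i j. (E n \<mu> $ i $ j - mat 1 $ i $ j) / of_real (\<tau> n)"
    have B1: "bounded ((\<lambda>\<mu>. - e * ?A \<mu> $ i $ j) ` ?K)" for i j
      by (intro compact_imp_bounded compact_continuous_image continuous_intros potential_continuous) auto
    note U4 = uniform_lim_mult[OF U2 U3 B1 Fb]
    have Fc: "continuous_on ?K (\<lambda>\<mu>. F z \<mu> $ i $ j)" for i j
      using loops[OF S(2)] unfolding loops_def by (auto intro!: continuous_intros)
    have "continuous_on ?K (D z)"
      by (rule continuous_on_compose2[OF Dcont, of _ "\<lambda>\<mu>. (z, \<mu>)", simplified])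
        (use S in \<open>auto intro!: continuous_intros\<close>)
    then have Dc: "continuous_on ?K (\<lambda>\<mu>. D z \<mu> $ i $ j)" for i j
      by (intro continuous_intros)
    \<comment> \<open>The discrete product rule: with \<open>F\<^sub>n\<close> the shifted frame, E
      F_n - F = (E - 1) F_n + (F_n - F). \<open>?X\<close> is the first column of this divided by
      \<open>\<tau> n\<close>.\<close>
    let ?X = "\<lambda>n \<mu> i. ?p n \<mu> i 1 * F (z + of_real (\<tau> n) * e) \<mu> $ 1 $ 1
        + ?p n \<mu> i 2 * F (z + of_real (\<tau> n) * e) \<mu> $ 2 $ 1 + ?q n \<mu> i 1"
    let ?Y = "\<lambda>\<mu> i. - e * ?A \<mu> $ i $ 1 * F z \<mu> $ 1 $ 1 + - e * ?A \<mu> $ i $ 2 * F z \<mu> $ 2 $ 1 + D z \<mu> $ i $ 1"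
    have U5: "uniform_limit ?K (\<lambda>n \<mu>. ?X n \<mu> i) (\<lambda>\<mu>. ?Y \<mu> i) sequentially" for i
      by (intro uniform_limit_add U4 U1)
    have Yb: "bounded ((\<lambda>\<mu>. ?Y \<mu> i) ` ?K)" for i
      by (intro compact_imp_bounded compact_continuous_image compact_sphere continuous_on_add
          continuous_on_mult continuous_on_const potential_continuous Fc Dc)
    have U6: "uniform_limit ?K (\<lambda>n \<mu>. F z \<mu> $ 2 $ 2 * ?X n \<mu> 1 - F z \<mu> $ 1 $ 2 * ?X n \<mu> 2)
       (\<lambda>\<mu>. F z \<mu> $ 2 $ 2 * ?Y \<mu> 1 - F z \<mu> $ 1 $ 2 * ?Y \<mu> 2) sequentially"
      by (intro uniform_limit_minus uniform_lim_mult U5 Yb Fb uniform_limit_const)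
    show ?thesis
    proof (rule uniform_limit_cong'[THEN iffD1, OF _ _ U6])
      fix \<mu> :: complex assume \<mu>: "\<mu> \<in> ?K"
      show "F z \<mu> $ 2 $ 2 * ?Y \<mu> 1 - F z \<mu> $ 1 $ 2 * ?Y \<mu> 2 = \<Psi> \<mu>"
        using F'D[OF \<mu>] by (simp add: \<Psi>_def matrix_mult_nth_2 algebra_simps)
      fix n
      have d: "F z \<mu> $ 2 $ 2 * F z \<mu> $ 1 $ 1 - F z \<mu> $ 1 $ 2 * F z \<mu> $ 2 $ 1 = 1"
        using SU11_loops(2)[OF loops[OF S(2)] \<mu>] by (simp add: det_2 mult.commute)
      have \<tau>X: "of_real (\<tau> n) * ?X n \<mu> i
          = (E n \<mu> $ i $ 1 - mat 1 $ i $ 1) * F (z + of_real (\<tau> n) * e) \<mu> $ 1 $ 1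
          + (E n \<mu> $ i $ 2 - mat 1 $ i $ 2) * F (z + of_real (\<tau> n) * e) \<mu> $ 2 $ 1
          + (F (z + of_real (\<tau> n) * e) \<mu> $ i $ 1 - F z \<mu> $ i $ 1)" for i
        using \<tau>(1)[of n] by (simp add: distrib_left)
      have "P n \<mu> - 1 = F z \<mu> $ 2 $ 2 * (of_real (\<tau> n) * ?X n \<mu> 1) - F z \<mu> $ 1 $ 2 * (of_real (\<tau> n) * ?X n \<mu> 2)"
        unfolding \<tau>X using d by (simp add: P_def matrix_mult_nth_2 mat_def algebra_simps)
      then show "F z \<mu> $ 2 $ 2 * ?X n \<mu> 1 - F z \<mu> $ 1 $ 2 * ?X n \<mu> 2 = (P n \<mu> - 1) / of_real (\<tau> n)"
        using \<tau>(1)[of n] by (simp add: eq_divide_eq algebra_simps)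
    qed
  qed
  have \<Psi>d: "disc_ext \<Psi>" by (rule disc_ext_uniform_limit[OF Pd Plim])
  obtain B where B: "B \<in> plus_loops" "\<And>\<mu>. \<mu> \<in> sphere 0 1 \<Longrightarrow>
      adj2 (F z \<mu>) ** potential a b c \<mu> ** F z \<mu> = B \<mu> ** potential a b c \<mu> ** adj2 (B \<mu>)"
    using extended_frame_conjugate[OF frame S(2)] by metis
  \<comment> \<open>\<open>?u\<close> differs from \<open>\<Psi>\<close> by e times an entry of B A
    B^-1, whose simple pole the factor \<open>\<mu>\<close> clears. As \<open>?u\<close> is even,
    the product is odd and the factor can be divided out again.\<close>
  have "disc_ext (\<lambda>\<mu>. \<mu> * ?u \<mu>)"
  proof (rule disc_ext_cong)
    let ?a = "\<lambda>\<mu> i j. \<mu> * ?A \<mu> $ i $ j"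
    let ?g = "\<lambda>\<mu>. \<mu> * \<Psi> \<mu> + e * ((B \<mu> $ 1 $ 1 * ?a \<mu> 1 1 + B \<mu> $ 1 $ 2 * ?a \<mu> 2 1) * B \<mu> $ 2 $ 2
         - (B \<mu> $ 1 $ 1 * ?a \<mu> 1 2 + B \<mu> $ 1 $ 2 * ?a \<mu> 2 2) * B \<mu> $ 2 $ 1)"
    show "disc_ext ?g"
      by (intro disc_ext_add disc_ext_diff disc_ext_mult[of "\<lambda>\<mu>. \<mu>" \<Psi>] disc_ext_mult[of "\<lambda>\<mu>. e"]
         disc_ext_mult[OF _ plus_loops_disc_ext[OF B(1)]] disc_ext_mult[OF plus_loops_disc_ext[OF B(1)]]
         potential_disc_ext disc_ext_const disc_ext_id \<Psi>d)
    show "\<mu> * ?u \<mu> = ?g \<mu>" if "\<mu> \<in> ?K" for \<mu>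
      by (simp only: \<Psi>_def B(2)[OF that]) (simp add: matrix_mult_nth_2 algebra_simps del: potential_nth)
  qed
  moreover have "- \<mu> * ?u (- \<mu>) = - (\<mu> * ?u \<mu>)" if "\<mu> \<in> ?K" for \<mu>
    using MC(4)[OF _ _ that] by simp
  ultimately have "disc_ext (\<lambda>\<mu>. \<mu> * ?u \<mu> / \<mu>)"
    by (rule disc_ext_divide_odd)
  then have "disc_ext ?u"
    by (rule disc_ext_cong) auto
  then show thesis
    using disc_ext_imaginary_constant[of ?u thesis] MC(3) that by blast
qed


section \<open>The surface in the quadric\<close>

lemma vec4_nth [simp]:
  fixes x :: "'a::zero"
  shows "(vector [x, y, z, w] :: 'a^4) $ 1 = x" "(vector [x, y, z, w] :: 'a^4) $ 2 = y"
    "(vector [x, y, z, w] :: 'a^4) $ 3 = z" "(vector [x, y, z, w] :: 'a^4) $ 4 = w"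
  by (simp_all add: vector_def)

lemma herm_eq:
  "herm z w = - z$1 * cnj (w$1) - z$2 * cnj (w$2) + z$3 * cnj (w$3) + z$4 * cnj (w$4)"
  by (simp add: herm_def bil_def cvec_def)

lemma herm_smult: "herm (t *s z) w = t * herm z w" "herm z (t *s w) = cnj t * herm z w"
  by (simp_all add: herm_eq algebra_simps)

lemma herm_scaleR: "herm (t *\<^sub>R z) w = t *\<^sub>R herm z w"
  by (simp add: herm_eq scaleR_conv_of_real[where 'a = complex] algebra_simps)

lemma herm_add: "herm (x + y) w = herm x w + herm y w"
  by (simp add: herm_eq algebra_simps)

lemma herm_diff: "herm (x - y) w = herm x w - herm y w"
  by (simp add: herm_eq algebra_simps)

lemma herm_cnj: "cnj (herm z w) = herm w z"
  by (simp add: herm_eq mult.commute)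

lemma pclass_smult: "t \<noteq> 0 \<Longrightarrow> pclass (t *s z) = pclass z"
proof -
  have *: "pclass (t *s z) \<subseteq> pclass z" if "t \<noteq> 0" for t z
    unfolding pclass_def using that by (auto simp: vector_smult_assoc)
  assume "t \<noteq> 0"
  then have "pclass (inverse t *s (t *s z)) \<subseteq> pclass (t *s z)" by (intro *) simp
  with \<open>t \<noteq> 0\<close> * show ?thesis by (auto simp: vector_smult_assoc)
qed

lemma pclass_self: "z \<in> pclass z"
  unfolding pclass_def by (rule CollectI, rule exI[of _ 1]) simp

text \<open>Under the complexified identification of vectors with matrices, the lift
  \<open>(X + i Y) / sqrt 2\<close> equals \<open>sqrt 2 g E\<^sub>2\<^sub>2 h\<^sup>-\<^sup>1\<close>, so only the second column of \<open>g\<close>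
  and the first column of \<open>h\<close> enter.\<close>

definition quad_vec :: "complex^2^2 \<Rightarrow> complex^2^2 \<Rightarrow> complex^4" where
  "quad_vec g h = (1 / of_real (sqrt 2)) *s vector
     [g$2$2 * h$1$1 - g$1$2 * h$2$1, \<i> * (g$2$2 * h$1$1 + g$1$2 * h$2$1),
      g$1$2 * h$1$1 - g$2$2 * h$2$1, \<i> * (g$1$2 * h$1$1 + g$2$2 * h$2$1)]"

lemma herm_smult_sqrt2:
  "herm ((1 / of_real (sqrt 2)) *s v) ((1 / of_real (sqrt 2)) *s w) = herm v w / 2"
proof -
  have "of_real (sqrt 2) * of_real (sqrt 2) = (2 :: complex)" by (simp flip: of_real_mult)
  then show ?thesis by (simp add: herm_smult)
qed

lemma std_lift_eq_quad_vec:
  assumes "F z \<mu> \<in> SU11" "F z (\<i> * \<mu>) \<in> SU11"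
  shows "std_lift F \<mu> z = quad_vec (F z \<mu>) (F z (\<i> * \<mu>))"
proof -
  obtain p q where g: "F z \<mu> = mat2 p q (cnj q) (cnj p)" by (rule SU11_E[OF assms(1)])
  obtain r s where h: "F z (\<i> * \<mu>) = mat2 r s (cnj s) (cnj r)" by (rule SU11_E[OF assms(2)])
  have inv: "matrix_inv (mat2 r s (cnj s) (cnj r)) = mat2 (cnj r) (- s) (- cnj s) r"
    using assms(2) by (subst matrix_inv_eq_adj2) (simp_all add: SU11_iff h adj2_def)
  show ?thesis
    unfolding vec_eq_iff forall_4
    by (simp add: std_lift_def surfX_def surfY_def g h inv quad_vec_def vec_of_mat_def
        sigma3_def mat2_mult cmul_mat2 complex_eq_iff Re_divide_of_real Im_divide_of_real
        diff_divide_distrib add_divide_distrib algebra_simps)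
qed

lemma bil_quad_vec: "bil (quad_vec g h) (quad_vec g h) = 0"
  by (simp add: bil_def quad_vec_def algebra_simps)

lemma herm_quad_vec:
  assumes "g \<in> SU11" "h \<in> SU11"
  shows "herm (quad_vec g h) (quad_vec g h) = - 1"
proof -
  obtain p q where g: "g = mat2 p q (cnj q) (cnj p)" "p * cnj p - q * cnj q = 1"
    by (rule SU11_E[OF assms(1)])
  obtain r s where h: "h = mat2 r s (cnj s) (cnj r)" "r * cnj r - s * cnj s = 1"
    by (rule SU11_E[OF assms(2)])
  have "2 * herm (quad_vec g h) (quad_vec g h)
      = - 2 * ((p * cnj p - q * cnj q) * (r * cnj r - s * cnj s))"
    unfolding quad_vec_def herm_smult_sqrt2 by (simp add: herm_eq g(1) h(1) field_simps)
  then show ?thesis by (simp add: g h)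
qed

text \<open>The derivative of the lift, paired with the lift, sees only the diagonal Maurer-Cartan
  entries of \<open>g\<close> and \<open>h\<close>. When these are one and the same imaginary
  number, the right side vanishes.\<close>

lemma herm_quad_vec_deriv:
  assumes "g \<in> SU11" "h \<in> SU11"
    and "g'$2$1 = cnj (g'$1$2)" "g'$2$2 = cnj (g'$1$1)"
    and "h'$2$1 = cnj (h'$1$2)" "h'$2$2 = cnj (h'$1$1)"
  shows "herm (quad_vec g' h + quad_vec g h') (quad_vec g h)
    = - cnj ((adj2 g ** g') $ 1 $ 1) - (adj2 h ** h') $ 1 $ 1"
proof -
  obtain p q where g: "g = mat2 p q (cnj q) (cnj p)" "p * cnj p - q * cnj q = 1"
    by (rule SU11_E[OF assms(1)])
  obtain r s where h: "h = mat2 r s (cnj s) (cnj r)" "r * cnj r - s * cnj s = 1"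
    by (rule SU11_E[OF assms(2)])
  \<comment> \<open>Inserting the determinants, both equal to 1, makes this a polynomial identity in
    the entries and their conjugates.\<close>
  have "2 * herm (quad_vec g' h + quad_vec g h') (quad_vec g h)
    = 2 * ((- cnj ((adj2 g ** g') $ 1 $ 1)) * (r * cnj r - s * cnj s)
         - (adj2 h ** h') $ 1 $ 1 * (p * cnj p - q * cnj q))"
    unfolding quad_vec_def herm_add herm_smult_sqrt2
    by (simp add: herm_eq g(1) h(1) assms(3-6) matrix_mult_nth_2 field_simps)
  then show ?thesis unfolding g(2) h(2) mult_1_right by (subst (asm) mult_cancel_left) simp
qed

section \<open>Horizontality and uniqueness of lifts\<close>

lemma has_derivative_vec_4:
  fixes f :: "'a::real_normed_vector \<Rightarrow> complex^4"
  assumes "\<And>i. ((\<lambda>x. f x $ i) has_derivative (\<lambda>h. f' h $ i)) (at x)"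
  shows "(f has_derivative f') (at x)"
proof (rule has_derivative_componentwise_within[THEN iffD2], rule ballI)
  fix b :: "complex^4" assume "b \<in> Basis"
  then obtain i c where b: "b = axis i c" by (auto simp: Basis_vec_def)
  show "((\<lambda>x. f x \<bullet> b) has_derivative (\<lambda>h. f' h \<bullet> b)) (at x)"
    unfolding b inner_axis
    by (rule bounded_linear.has_derivative[OF bounded_linear_inner_left assms])
qed

lemma has_derivative_quad_vec:
  assumes g: "(g has_derivative g') (at z)" and h: "(h has_derivative h') (at z)"
  shows "((\<lambda>w. quad_vec (g w) (h w)) has_derivative
     (\<lambda>e. quad_vec (g' e) (h z) + quad_vec (g z) (h' e))) (at z)"
proof -
  have G: "((\<lambda>w. g w $ i $ j) has_derivative (\<lambda>h. g' h $ i $ j)) (at z)" for i j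
    by (intro bounded_linear.has_derivative[OF bounded_linear_vec_nth] g)
  have H: "((\<lambda>w. h w $ i $ j) has_derivative (\<lambda>k. h' k $ i $ j)) (at z)" for i j
    by (intro bounded_linear.has_derivative[OF bounded_linear_vec_nth] h)
  have "\<forall>i. ((\<lambda>w. quad_vec (g w) (h w) $ i) has_derivative
     (\<lambda>e. (quad_vec (g' e) (h z) + quad_vec (g z) (h' e)) $ i)) (at z)"
    unfolding forall_4 quad_vec_def vector_add_component vector_smult_component vec4_nth
    by (intro conjI; rule has_derivative_eq_rhs, (rule derivative_intros G H)+)
      (auto simp: fun_eq_iff algebra_simps)
  then show ?thesis by (intro has_derivative_vec_4) blast
qed

text \<open>The two Wirtinger pairings are invertible combinations of the pairings in the directions
  1 and \<open>\<i>\<close>, which span all real directions.\<close>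

lemma horizontal_iff:
  assumes "f differentiable (at z)"
  shows "bil (d_z f z) (cvec (f z)) = 0 \<and> bil (d_zbar f z) (cvec (f z)) = 0
    \<longleftrightarrow> (\<forall>h. herm (frechet_derivative f (at z) h) (f z) = 0)"
proof -
  let ?D = "frechet_derivative f (at z)"
  have "linear ?D" by (rule linear_frechet_derivative[OF assms])
  have dec: "?D h = Re h *\<^sub>R ?D 1 + Im h *\<^sub>R ?D \<i>" for h
  proof -
    have "h = Re h *\<^sub>R 1 + Im h *\<^sub>R \<i>" by (simp add: complex_eq_iff)
    then have "?D h = ?D (Re h *\<^sub>R 1 + Im h *\<^sub>R \<i>)" by (rule arg_cong)
    also have "\<dots> = Re h *\<^sub>R ?D 1 + Im h *\<^sub>R ?D \<i>"
      by (simp only: linear_add[OF \<open>linear ?D\<close>] linear_cmul[OF \<open>linear ?D\<close>])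
    finally show ?thesis .
  qed
  have *: "herm (?D h) (f z) = Re h *\<^sub>R herm (?D 1) (f z) + Im h *\<^sub>R herm (?D \<i>) (f z)" for h
    by (subst dec) (simp add: herm_add herm_scaleR)
  have z: "bil (d_z f z) (cvec (f z)) = (herm (?D 1) (f z) - \<i> * herm (?D \<i>) (f z)) / 2"
    by (simp add: d_z_def herm_smult herm_diff flip: herm_def)
  have zb: "bil (d_zbar f z) (cvec (f z)) = (herm (?D 1) (f z) + \<i> * herm (?D \<i>) (f z)) / 2"
    by (simp add: d_zbar_def herm_smult herm_add flip: herm_def)
  show ?thesis
  proof
    assume a: "bil (d_z f z) (cvec (f z)) = 0 \<and> bil (d_zbar f z) (cvec (f z)) = 0"
    have "herm (?D 1) (f z) = bil (d_z f z) (cvec (f z)) + bil (d_zbar f z) (cvec (f z))"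
      "\<i> * herm (?D \<i>) (f z) = bil (d_zbar f z) (cvec (f z)) - bil (d_z f z) (cvec (f z))"
      unfolding z zb by (simp_all add: field_simps)
    with a have "herm (?D 1) (f z) = 0" "herm (?D \<i>) (f z) = 0" by simp_all
    then show "\<forall>h. herm (?D h) (f z) = 0" by (subst *) simp
  next
    assume "\<forall>h. herm (?D h) (f z) = 0"
    then show "bil (d_z f z) (cvec (f z)) = 0 \<and> bil (d_zbar f z) (cvec (f z)) = 0"
      by (simp add: z zb)
  qed
qed

lemma has_derivative_herm:
  assumes "(f has_derivative f') (at z)" "(g has_derivative g') (at z)"
  shows "((\<lambda>w. herm (f w) (g w)) has_derivative (\<lambda>h. herm (f' h) (g z) + herm (f z) (g' h))) (at z)"
proof -
  have F: "((\<lambda>w. f w $ i) has_derivative (\<lambda>h. f' h $ i)) (at z)" for i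
    by (rule bounded_linear.has_derivative[OF bounded_linear_vec_nth assms(1)])
  have G: "((\<lambda>w. cnj (g w $ i)) has_derivative (\<lambda>h. cnj (g' h $ i))) (at z)" for i
    by (intro has_derivative_cnj bounded_linear.has_derivative[OF bounded_linear_vec_nth assms(2)])
  show ?thesis
    unfolding herm_eq
    by (rule has_derivative_eq_rhs, (rule derivative_intros F G)+) (simp add: fun_eq_iff algebra_simps)
qed

text \<open>Two lifts in \<open>H73\<close> differ pointwise by a unimodular \<open>t\<close>, and
  their pairing \<open>?s\<close> equals \<open>- t\<close>. Horizontality of both lifts kills the
  derivative of \<open>?s\<close>, so it is constant on a convex set.\<close>

lemma horizontal_lift_unique:
  assumes "convex S" and f: "horizontal_lift S \<phi> f" and g: "horizontal_lift S \<phi> g"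
  obtains k where "\<And>z. z \<in> S \<Longrightarrow> f z = k *s g z"
proof -
  let ?Df = "\<lambda>z. frechet_derivative f (at z)" and ?Dg = "\<lambda>z. frechet_derivative g (at z)"
  let ?s = "\<lambda>z. herm (f z) (g z)"
  have s: "f z = (- ?s z) *s g z \<and> (?s has_derivative (\<lambda>h. 0)) (at z within S)" if z: "z \<in> S" for z
  proof -
    have H: "herm (f z) (f z) = -1" "herm (g z) (g z) = -1"
      using f g z by (auto simp: horizontal_lift_def H73_def)
    have df: "(f has_derivative ?Df z) (at z)" and dg: "(g has_derivative ?Dg z) (at z)"
      using f g z by (auto simp: horizontal_lift_def frechet_derivative_works)
    have hf: "herm (?Df z h) (f z) = 0" and hg: "herm (?Dg z h) (g z) = 0" for h
      using f g z horizontal_iff[of f z] horizontal_iff[of g z] by (auto simp: horizontal_lift_def)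
    have "f z \<in> pclass (g z)"
      using f g z pclass_self[of "f z"] by (auto simp: horizontal_lift_def)
    then obtain t where t: "f z = t *s g z" "t \<noteq> 0" unfolding pclass_def by blast
    have tt: "t * cnj t = 1" using H by (simp add: t herm_smult mult.commute)
    have st: "?s z = - t" by (simp add: t(1) herm_smult H)
    have gt: "g z = cnj t *s f z"
      using tt by (simp add: t(1) vector_smult_assoc mult.commute)
    have "herm (?Df z h) (g z) = 0" for h
      by (subst gt) (simp add: herm_smult hf)
    moreover have "herm (f z) (?Dg z h) = 0" for h
    proof -
      have "herm (f z) (?Dg z h) = t * cnj (herm (?Dg z h) (g z))"
        by (simp add: t(1) herm_smult herm_cnj)
      then show ?thesis by (simp add: hg)
    qed
    ultimately have "(?s has_derivative (\<lambda>h. 0)) (at z)"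
      using has_derivative_herm[OF df dg] by simp
    then show ?thesis using t st by (auto intro: has_derivative_at_withinI)
  qed
  then obtain c where "\<And>z. z \<in> S \<Longrightarrow> ?s z = c"
    using has_derivative_zero_constant[OF \<open>convex S\<close>, of ?s] by blast
  with s have "f z = (- c) *s g z" if "z \<in> S" for z using that by metis
  then show thesis by (rule that)
qed

lemma horizontal_lift_std_lift:
  assumes frame: "extended_frame (potential a b c) S F" and "open S" and \<mu>: "\<mu> \<in> sphere 0 1"
  shows "horizontal_lift S (surf F \<mu>) (std_lift F \<mu>)"
  unfolding horizontal_lift_def
proof (intro ballI)
  fix z assume z: "z \<in> S"
  have i\<mu>: "\<i> * \<mu> \<in> sphere 0 1" using \<mu> by (simp add: norm_mult)
  note loops = extended_frame_loops[OF frame]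
  obtain F' where F': "((\<lambda>w. F w \<mu>) has_derivative F' \<mu>) (at z)" if "\<mu> \<in> sphere 0 1" for \<mu>
  proof -
    obtain Fx Fy where "\<And>\<mu>. \<mu> \<in> sphere 0 1 \<Longrightarrow>
        ((\<lambda>w. F w \<mu>) has_derivative (\<lambda>h. Re h *\<^sub>R Fx z \<mu> + Im h *\<^sub>R Fy z \<mu>)) (at z)"
      using frame z unfolding extended_frame_def C1_loop_map_def by meson
    then show thesis by (rule that)
  qed
  note MC = maurer_cartan_SU11_loops[OF \<open>open S\<close> z loops F']
  have SU: "F w \<mu> \<in> SU11" "F w (\<i> * \<mu>) \<in> SU11" if "w \<in> S" for w
    using SU11_loops(1)[OF loops[OF that]] \<mu> i\<mu> by auto
  have eq: "std_lift F \<mu> w = quad_vec (F w \<mu>) (F w (\<i> * \<mu>))" if "w \<in> S" for w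
    using std_lift_eq_quad_vec SU[OF that] by blast
  let ?D = "\<lambda>e. quad_vec (F' \<mu> e) (F z (\<i> * \<mu>)) + quad_vec (F z \<mu>) (F' (\<i> * \<mu>) e)"
  have D: "(std_lift F \<mu> has_derivative ?D) (at z)"
    by (rule has_derivative_transform_within_open[OF has_derivative_quad_vec[OF F'[OF \<mu>] F'[OF i\<mu>]]
          \<open>open S\<close> z]) (simp add: eq)
  have "herm (?D e) (std_lift F \<mu> z) = 0" for e
  proof -
    \<comment> \<open>The entries at \<open>\<mu>\<close> and \<open>\<i> * \<mu>\<close> are the
      same imaginary \<open>k\<close>, so the pairing is - cnj k - k = 0.\<close>
    obtain k where k: "\<And>\<mu>. \<mu> \<in> sphere 0 1 \<Longrightarrow> (adj2 (F z \<mu>) ** F' \<mu> e) $ 1 $ 1 = k"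
      using extended_frame_diagonal_constant[OF frame \<open>open S\<close> z F'] by metis
    have "Re k = 0" using MC(3)[OF _ _ \<mu>, of e] k[OF \<mu>] by simp
    then have "cnj k = - k" by (simp add: complex_eq_iff)
    have "herm (?D e) (std_lift F \<mu> z)
      = - cnj ((adj2 (F z \<mu>) ** F' \<mu> e) $ 1 $ 1) - (adj2 (F z (\<i> * \<mu>)) ** F' (\<i> * \<mu>) e) $ 1 $ 1"
      unfolding eq[OF z] using MC(1,2)[OF _ _ \<mu>, of e] MC(1,2)[OF _ _ i\<mu>, of e]
      by (intro herm_quad_vec_deriv SU z) auto
    then show ?thesis using k[OF \<mu>] k[OF i\<mu>] \<open>cnj k = - k\<close> by simp
  qed
  moreover have "std_lift F \<mu> differentiable (at z)"
    using D by (rule differentiableI)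
  moreover have "frechet_derivative (std_lift F \<mu>) (at z) = ?D"
    using frechet_derivative_at[OF D] by simp
  ultimately have "bil (d_z (std_lift F \<mu>) z) (cvec (std_lift F \<mu> z)) = 0 \<and>
      bil (d_zbar (std_lift F \<mu>) z) (cvec (std_lift F \<mu> z)) = 0"
    by (simp add: horizontal_iff)
  moreover have "std_lift F \<mu> z \<in> H73"
    by (simp add: H73_def eq[OF z] herm_quad_vec SU[OF z])
  ultimately show "std_lift F \<mu> differentiable (at z) \<and> std_lift F \<mu> z \<in> H73 \<and>
      pclass (std_lift F \<mu> z) = surf F \<mu> z \<and>
      bil (d_z (std_lift F \<mu>) z) (cvec (std_lift F \<mu> z)) = 0 \<and>
      bil (d_zbar (std_lift F \<mu>) z) (cvec (std_lift F \<mu> z)) = 0"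
    using \<open>std_lift F \<mu> differentiable (at z)\<close> by (simp add: surf_def)
qed

text \<open>A continuous surjection from a real vector space onto SU(1,1), with \<open>t\<close> the
  argument of the upper left entry. It supplies the connectedness needed for the component
  \<open>Q2star\<close>.\<close>

definition su11_param :: "real \<Rightarrow> complex \<Rightarrow> complex^2^2" where
  "su11_param t q = mat2 (of_real (sqrt (1 + (norm q)\<^sup>2)) * cis t) q
     (cnj q) (cnj (of_real (sqrt (1 + (norm q)\<^sup>2)) * cis t))"

lemma su11_param_in_SU11: "su11_param t q \<in> SU11"
proof -
  define R where "R = sqrt (1 + (norm q)\<^sup>2)"
  have "R * R = 1 + (norm q)\<^sup>2" by (simp add: R_def add_nonneg_nonneg)
  then have "of_real R * of_real R = (1 + q * cnj q :: complex)"
    by (metis complex_norm_square of_real_1 of_real_add of_real_mult)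
  moreover have "of_real R * cis t * cnj (of_real R * cis t) = (of_real R * of_real R) * (cis t * cnj (cis t))"
    by (simp add: mult_ac)
  moreover have "cis t * cnj (cis t) = 1" by (simp add: cis_cnj cis_mult)
  ultimately have "of_real R * cis t * cnj (of_real R * cis t) - q * cnj q = 1" by simp
  then show ?thesis unfolding su11_param_def R_def by (rule mat2_in_SU11)
qed

lemma su11_param_surj:
  assumes "g \<in> SU11"
  obtains t q where "g = su11_param t q"
proof -
  obtain p q where g: "g = mat2 p q (cnj q) (cnj p)" "p * cnj p - q * cnj q = 1"
    by (rule SU11_E[OF assms])
  have "complex_of_real ((norm p)\<^sup>2) = of_real (1 + (norm q)\<^sup>2)"
    using g(2) by (simp add: complex_norm_square algebra_simps del: of_real_power)
  then have "(norm p)\<^sup>2 = 1 + (norm q)\<^sup>2" using of_real_eq_iff by blast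
  then have "norm p = sqrt (1 + (norm q)\<^sup>2)" by (metis norm_ge_zero real_sqrt_unique)
  then have "p = of_real (sqrt (1 + (norm q)\<^sup>2)) * cis (Arg p)"
    by (metis rcis_cmod_Arg rcis_def)
  then show thesis using g(1) that unfolding su11_param_def by metis
qed

text \<open>All points [\<open>quad_vec g h\<close>] form a continuous image of a connected
  parameter space inside the null quadric, and this image contains the base point.\<close>

lemma quad_vec_in_Q2star:
  assumes "g \<in> SU11" "h \<in> SU11"
  shows "pclass (quad_vec g h) \<in> Q2star"
proof -
  let ?Q = "{P \<in> CH31. \<forall>z\<in>P. bil z z = 0}"
  define V where "V x = quad_vec (su11_param (fst x) (fst (snd x)))
      (su11_param (fst (snd (snd x))) (snd (snd (snd x))))" for x :: "real \<times> complex \<times> real \<times> complex"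
  have herm: "herm (V x) (V x) = -1" for x
    unfolding V_def by (intro herm_quad_vec su11_param_in_SU11)
  have V0: "V x \<noteq> 0" for x using herm[of x] by (auto simp: herm_eq)
  have "continuous_on UNIV (\<lambda>x. V x $ i)" for i
  proof -
    have "\<forall>i. continuous_on UNIV (\<lambda>x. V x $ i)"
      unfolding forall_4 V_def quad_vec_def su11_param_def vector_smult_component vec4_nth mat2_nth
      by (intro conjI continuous_intros) auto
    then show ?thesis by blast
  qed
  from continuous_on_vec_lambda[of UNIV "\<lambda>i x. V x $ i", OF this]
  have V: "continuous_on UNIV V" by simp
  have "continuous_map euclidean CP3_top (\<lambda>x. pclass (V x))"
    unfolding continuous_map_def
  proof (intro conjI allI impI)
    show "(\<lambda>x. pclass (V x)) \<in> topspace euclidean \<rightarrow> topspace CP3_top"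
    proof
      fix x
      have "openin CP3_top CP3"
      proof -
        have "{z :: complex^4. z \<noteq> 0 \<and> pclass z \<in> CP3} = - {0}" unfolding CP3_def by auto
        then show ?thesis by (simp add: openin_CP3_top open_Compl)
      qed
      moreover have "pclass (V x) \<in> CP3" unfolding CP3_def using V0 by blast
      ultimately show "pclass (V x) \<in> topspace CP3_top" using openin_subset by blast
    qed
    fix U assume "openin CP3_top U"
    then have "open (V -` {z. z \<noteq> 0 \<and> pclass z \<in> U})"
      using V by (intro open_vimage) (auto simp: openin_CP3_top)
    moreover have "V -` {z. z \<noteq> 0 \<and> pclass z \<in> U} = {x \<in> topspace euclidean. pclass (V x) \<in> U}"
      using V0 by auto
    ultimately show "openin euclidean {x \<in> topspace euclidean. pclass (V x) \<in> U}" by simp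
  qed
  then have "connectedin CP3_top ((\<lambda>x. pclass (V x)) ` UNIV)"
    by (rule connectedin_continuous_map_image) (simp add: connected_UNIV)
  moreover have sub: "(\<lambda>x. pclass (V x)) ` UNIV \<subseteq> ?Q"
  proof
    fix P assume "P \<in> (\<lambda>x. pclass (V x)) ` UNIV"
    then obtain x where P: "P = pclass (V x)" by blast
    have "P \<in> CH31" unfolding CH31_def P using herm[of x] by (intro CollectI exI[of _ "V x"]) simp
    moreover have "bil z z = 0" if zP: "z \<in> P" for z
    proof -
      obtain t where "z = t *s V x" using zP unfolding P pclass_def by blast
      then have "bil z z = t * t * bil (V x) (V x)" by (simp add: bil_def algebra_simps)
      then show ?thesis by (simp add: V_def bil_quad_vec)
    qed
    ultimately show "P \<in> ?Q" by blast
  qed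
  ultimately have con: "connectedin (subtopology CP3_top ?Q) ((\<lambda>x. pclass (V x)) ` UNIV)"
    by (simp add: connectedin_subtopology)
  \<comment> \<open>Zero parameters give the pair of identity matrices, which lies over the base
    point of \<open>Q2star\<close>.\<close>
  have "V (0, 0, 0, 0) = (1 / of_real (sqrt 2)) *s vector [1, \<i>, 0, 0]"
    by (simp add: V_def quad_vec_def su11_param_def)
  then have base: "pclass (vector [1, \<i>, 0, 0]) = pclass (V (0, 0, 0, 0))"
    by (simp add: pclass_smult)
  obtain t q where g: "g = su11_param t q" by (rule su11_param_surj[OF assms(1)])
  obtain t' q' where h: "h = su11_param t' q'" by (rule su11_param_surj[OF assms(2)])
  have "quad_vec g h = V (t, q, t', q')" by (simp add: V_def g h)
  then have "connected_component_of (subtopology CP3_top ?Q)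
      (pclass (vector [1, \<i>, 0, 0])) (pclass (quad_vec g h))"
    unfolding connected_component_of_def base using con by (intro exI conjI) auto
  then show ?thesis by (simp add: Q2star_def)
qed

section \<open>Equivariance of the lift under \<open>psi\<close>\<close>

lemma vec_of_mat_inverse: "N$2$2 = cnj (N$1$1) \<Longrightarrow> N$1$2 = cnj (N$2$1) \<Longrightarrow> mat_of_vec (vec_of_mat N) = N"
  by (simp add: mat_of_vec_def vec_of_mat_def vec_eq_iff forall_2 Let_def complex_eq_iff)

text \<open>\<open>matrix\<close> represents a map only if it is linear; real linearity in
  \<open>x\<close> holds for arbitrary \<open>g\<close> and \<open>h\<close>.\<close>

lemma psi_pt_works: "psi_pt g h *v x = vec_of_mat (g ** mat_of_vec x ** matrix_inv h)"
proof -
  have "linear (\<lambda>x. vec_of_mat (g ** mat_of_vec x ** matrix_inv h))"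
    by (intro linearI) (simp_all add: vec_of_mat_def mat_of_vec_def Let_def vec_eq_iff forall_4
        matrix_mult_nth_2 algebra_simps)
  then show ?thesis by (simp add: psi_pt_def matrix_works)
qed

lemma adj2_matrix_mult: "adj2 (M ** N) = adj2 N ** adj2 M"
  by (simp add: vec_eq_iff forall_2 matrix_mult_nth_2 algebra_simps)

lemma std_lift_equivariant:
  assumes frame: "extended_frame (potential a b c) S F" and z: "z \<in> S" "z + \<i> * of_real \<theta> \<in> S"
    and \<mu>: "\<mu> \<in> sphere 0 1"
  shows "std_lift F \<mu> (z + \<i> * of_real \<theta>) =
    psi (\<lambda>\<zeta>. mexp (cmul (\<i> * of_real \<theta>) (potential a b c \<zeta>)))
        (\<lambda>\<zeta>. mexp (cmul (\<i> * of_real \<theta>) (potential a b c (\<i> * \<zeta>)))) \<mu> *v std_lift F \<mu> z"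
proof -
  let ?e = "\<lambda>\<mu>. mexp (cmul (\<i> * of_real \<theta>) (potential a b c \<mu>))"
  let ?g = "?e \<mu>" and ?h = "?e (\<i> * \<mu>)" and ?w = "z + \<i> * of_real \<theta>"
  have i\<mu>: "\<i> * \<mu> \<in> sphere 0 1" using \<mu> by (simp add: norm_mult)
  obtain k where k: "k * cnj k = 1"
    "\<And>\<mu>. \<mu> \<in> sphere 0 1 \<Longrightarrow> F ?w \<mu> = ?e \<mu> ** F z \<mu> ** mat2 k 0 0 (cnj k)"
    using extended_frame_equivariant[OF frame z] by metis
  let ?K = "mat2 k 0 0 (cnj k)"
  have SU: "F w \<zeta> \<in> SU11" if "w \<in> S" "\<zeta> \<in> sphere 0 1" for w \<zeta>
    using SU11_loops(1)[OF extended_frame_loops[OF frame that(1)] that(2)] .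
  have inv: "matrix_inv M = adj2 M" if "M \<in> SU11" for M
    using that by (intro matrix_inv_eq_adj2) (simp add: SU11_iff)
  have eS: "?e \<zeta> \<in> SU11" if "\<zeta> \<in> sphere 0 1" for \<zeta> by (rule mexp_potential_in_SU11[OF that])
  \<comment> \<open>The diagonal factor is the same at \<open>\<mu>\<close> and
    \<open>\<i> * \<mu>\<close> and commutes with \<open>sigma3\<close>, so it cancels in both X and
    Y.\<close>
  have K0: "?K ** adj2 ?K = mat 1" "?K ** sigma3 ** adj2 ?K = sigma3"
    using k(1) by (simp_all add: mat_eq_mat2 sigma3_def adj2_def mat2_mult mult.commute)
  have K: "X ** ?K ** adj2 ?K = X" "X ** ?K ** sigma3 ** adj2 ?K = X ** sigma3" for X
    using K0 by (simp_all add: matrix_mul_assoc[symmetric])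
  \<comment> \<open>Both products, the second because \<open>\<i>\<close> times
    \<open>sigma3\<close> is in SU(1,1), lie in the range of \<open>mat_of_vec\<close>, where
    \<open>vec_of_mat\<close> is a true inverse.\<close>
  have conj: "mat_of_vec (vec_of_mat (X ** adj2 Y)) = X ** adj2 Y"
     "mat_of_vec (vec_of_mat (cmul \<i> (X ** sigma3 ** adj2 Y))) = cmul \<i> (X ** sigma3 ** adj2 Y)"
    if "X \<in> SU11" "Y \<in> SU11" for X Y
    using that
    by (auto intro!: vec_of_mat_inverse simp: SU11_iff matrix_mult_nth_2 cmul_nth sigma3_def algebra_simps)
  have cm: "cmul \<i> (X ** Y ** Z) = X ** cmul \<i> Y ** Z" for X Y Z
    by (simp add: vec_eq_iff forall_2 matrix_mult_nth_2 cmul_nth algebra_simps)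
  note SUs = SU[OF z(1) \<mu>] SU[OF z(1) i\<mu>]
  note invs = inv[OF SU[OF z(1) i\<mu>]] inv[OF SU[OF z(2) i\<mu>], unfolded k(2)[OF i\<mu>]] inv[OF eS[OF i\<mu>]]
  have X: "surfX F \<mu> ?w = psi_pt ?g ?h *v surfX F \<mu> z"
    unfolding surfX_def psi_pt_works invs conj(1)[OF SUs] k(2)[OF \<mu>] k(2)[OF i\<mu>]
    by (simp add: adj2_matrix_mult matrix_mul_assoc K)
  have Y: "surfY F \<mu> ?w = psi_pt ?g ?h *v surfY F \<mu> z"
    unfolding surfY_def psi_pt_works invs conj(2)[OF SUs] k(2)[OF \<mu>] k(2)[OF i\<mu>] cm[symmetric]
    by (simp add: adj2_matrix_mult matrix_mul_assoc K)
  show ?thesis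
    unfolding std_lift_def X Y psi_def
    by (simp add: vec_eq_iff matrix_vector_mult_def map_matrix_def sum_distrib_left sum_divide_distrib
        sum.distrib[symmetric] field_simps)
qed

theorem proposition3p2:
  fixes a b c :: real and I :: "real set" and F :: "complex \<Rightarrow> complex \<Rightarrow> complex^2^2"
  assumes "a \<noteq> 0" and "b \<noteq> 0"
    and "open I" and "is_interval I" and "0 \<in> I"
    and "extended_frame (potential a b c) (strip I) F"
  shows "\<forall>\<mu>\<in>sphere 0 1.
      surf F \<mu> ` strip I \<subseteq> Q2star \<and>
      horizontal_lift (strip I) (surf F \<mu>) (std_lift F \<mu>) \<and>
      (\<forall>fh. horizontal_lift (strip I) (surf F \<mu>) fh \<longrightarrow>
        (\<forall>\<theta>::real. \<forall>z\<in>strip I.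
          fh (z + \<i> * of_real \<theta>) =
            psi (\<lambda>\<zeta>. mexp (cmul (\<i> * of_real \<theta>) (potential a b c \<zeta>)))
                (\<lambda>\<zeta>. mexp (cmul (\<i> * of_real \<theta>) (potential a b c (\<i> * \<zeta>)))) \<mu> *v fh z))"
proof (intro ballI conjI allI impI)
  note frame = \<open>extended_frame (potential a b c) (strip I) F\<close>
  have preimage: "strip I = Re -` I" by (auto simp: strip_def)
  have S: "open (strip I)" "convex (strip I)"
    unfolding preimage using \<open>open I\<close> \<open>is_interval I\<close>
    by (auto intro!: open_vimage convex_linear_vimage continuous_intros
        simp: is_interval_convex_1 bounded_linear.linear[OF bounded_linear_Re])
  fix \<mu> :: complex assume \<mu>: "\<mu> \<in> sphere 0 1"
  then have i\<mu>: "\<i> * \<mu> \<in> sphere 0 1" by (simp add: norm_mult)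
  show "surf F \<mu> ` strip I \<subseteq> Q2star"
  proof (rule image_subsetI)
    fix z assume z: "z \<in> strip I"
    note SU = SU11_loops(1)[OF extended_frame_loops[OF frame z]]
    show "surf F \<mu> z \<in> Q2star"
      unfolding surf_def std_lift_eq_quad_vec[where F = F, OF SU[OF \<mu>] SU[OF i\<mu>]]
      by (rule quad_vec_in_Q2star[OF SU[OF \<mu>] SU[OF i\<mu>]])
  qed
  show lift: "horizontal_lift (strip I) (surf F \<mu>) (std_lift F \<mu>)"
    by (rule horizontal_lift_std_lift[OF frame S(1) \<mu>])
  fix fh \<theta> z assume fh: "horizontal_lift (strip I) (surf F \<mu>) fh" and z: "z \<in> strip I"
  \<comment> \<open>An arbitrary horizontal lift is a constant multiple of the standard one, and the
    complex linear map given by \<open>psi\<close> commutes with that scalar.\<close>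
  obtain k where k: "\<And>z. z \<in> strip I \<Longrightarrow> fh z = k *s std_lift F \<mu> z"
    using horizontal_lift_unique[OF S(2) fh lift] by metis
  have z': "z + \<i> * of_real \<theta> \<in> strip I" using z by (simp add: strip_def)
  show "fh (z + \<i> * of_real \<theta>) =
            psi (\<lambda>\<zeta>. mexp (cmul (\<i> * of_real \<theta>) (potential a b c \<zeta>)))
                (\<lambda>\<zeta>. mexp (cmul (\<i> * of_real \<theta>) (potential a b c (\<i> * \<zeta>)))) \<mu> *v fh z"
    unfolding k[OF z] k[OF z'] std_lift_equivariant[OF frame z z' \<mu>]
    by (simp add: vector_scalar_commute)
qed

end
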